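(* Let $q$ be a power of an odd prime $p$, $K$ an algebraic closure of $\mathbb{F}_q$, and $\mathrm{PGL}(2,q)$ the subgroup of $\mathrm{PGL}(3,q)$ generated by $(X,Y,Z)\mapsto(Z,Y,X)$, $(X,Y,Z)\mapsto(X+aY+\tfrac12a^2Z,\,Y+aZ,\,Z)$ ($a\in\mathbb{F}_q$) and $(X,Y,Z)\mapsto(b^2X,bY,Z)$ ($b\in\mathbb{F}_q^*$). If $\mathcal C$ is a $\mathrm{PGL}(2,q)$-invariant irreducible plane curve over $K$ of degree $d$ with $2<d<q^2-q$, then $\mathcal C$ is either the Hermitian curve $Y^{q+1}-(X^qZ+XZ^q)=0$, or it has homogeneous equation $$Y^{q+1}-(X^{q}Z+XZ^q)-\lambda(Y^{2}-2XZ)^{(q+1)/2}=0$$ for some $\lambda\in K$.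
   Context: A curve is invariant under a group of projectivities if every element maps it onto itself; irreducible means irreducible over $K$. *)

theory Defs
  imports "HOL-Computational_Algebra.Computational_Algebra"
begin

text \<open>Ternary (homogeneous) polynomials over a field are represented as nested
univariate polynomials: the innermost variable is X, the middle one Y, the outer one Z.
The coefficient of X^i Y^j Z^k of F is coeff (coeff (coeff F k) j) i.\<close>

type_synonym 'a poly3 = "'a poly poly poly"

definition mono3 :: "'a::comm_ring_1 \<Rightarrow> nat \<Rightarrow> nat \<Rightarrow> nat \<Rightarrow> 'a poly3" where
  "mono3 c i j k = monom (monom (monom c i) j) k"

definition coeff3 :: "'a::zero poly3 \<Rightarrow> nat \<Rightarrow> nat \<Rightarrow> nat \<Rightarrow> 'a" where
  "coeff3 F i j k = coeff (coeff (coeff F k) j) i"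

definition varX :: "'a::comm_ring_1 poly3" where "varX = mono3 1 1 0 0"
definition varY :: "'a::comm_ring_1 poly3" where "varY = mono3 1 0 1 0"
definition varZ :: "'a::comm_ring_1 poly3" where "varZ = mono3 1 0 0 1"
definition const3 :: "'a::comm_ring_1 \<Rightarrow> 'a poly3" where "const3 c = mono3 c 0 0 0"

definition eval3 :: "'a::comm_ring_1 poly3 \<Rightarrow> 'a \<times> 'a \<times> 'a \<Rightarrow> 'a" where
  "eval3 F v = (case v of (x, y, z) \<Rightarrow> poly (poly (poly F [:[:z:]:]) [:y:]) x)"

definition homogeneous3 :: "'a::zero poly3 \<Rightarrow> nat \<Rightarrow> bool" where
  "homogeneous3 F d \<longleftrightarrow> (\<forall>i j k. coeff3 F i j k \<noteq> 0 \<longrightarrow> i + j + k = d)"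

text \<open>Points of the projective plane curve F = 0, represented on the affine cone
(nonzero vectors; the set is closed under nonzero scaling).\<close>
definition curve_points :: "'a::comm_ring_1 poly3 \<Rightarrow> ('a \<times> 'a \<times> 'a) set" where
  "curve_points F = {v. v \<noteq> (0, 0, 0) \<and> eval3 F v = 0}"

definition Fq :: "nat \<Rightarrow> 'a::field set" where
  "Fq q = {x. x ^ q = x}"

definition alg_closed :: "'a::field itself \<Rightarrow> bool" where
  "alg_closed _ \<longleftrightarrow> (\<forall>P::'a poly. degree P \<ge> 1 \<longrightarrow> (\<exists>x. poly P x = 0))"

definition algebraic_over :: "'a::field set \<Rightarrow> bool" where
  "algebraic_over S \<longleftrightarrow> (\<forall>x::'a. \<exists>P. P \<noteq> 0 \<and> (\<forall>i. coeff P i \<in> S) \<and> poly P x = 0)"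

definition gen_swap :: "'a::field \<times> 'a \<times> 'a \<Rightarrow> 'a \<times> 'a \<times> 'a" where
  "gen_swap v = (case v of (x, y, z) \<Rightarrow> (z, y, x))"

definition gen_trans :: "'a::field \<Rightarrow> 'a \<times> 'a \<times> 'a \<Rightarrow> 'a \<times> 'a \<times> 'a" where
  "gen_trans a v = (case v of (x, y, z) \<Rightarrow> (x + a * y + (a ^ 2 / 2) * z, y + a * z, z))"

definition gen_scale :: "'a::field \<Rightarrow> 'a \<times> 'a \<times> 'a \<Rightarrow> 'a \<times> 'a \<times> 'a" where
  "gen_scale b v = (case v of (x, y, z) \<Rightarrow> (b ^ 2 * x, b * y, z))"

text \<open>The group generated by the generators (closure under composition; since the
generated group is finite, this equals the generated group).\<close>
inductive_set PGL2 :: "nat \<Rightarrow> (('a::field \<times> 'a \<times> 'a) \<Rightarrow> ('a \<times> 'a \<times> 'a)) set"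
  for q :: nat where
  PGL2_id: "id \<in> PGL2 q"
| PGL2_swap: "g \<in> PGL2 q \<Longrightarrow> gen_swap \<circ> g \<in> PGL2 q"
| PGL2_trans: "a \<in> Fq q \<Longrightarrow> g \<in> PGL2 q \<Longrightarrow> gen_trans a \<circ> g \<in> PGL2 q"
| PGL2_scale: "b \<in> Fq q \<Longrightarrow> b \<noteq> 0 \<Longrightarrow> g \<in> PGL2 q \<Longrightarrow> gen_scale b \<circ> g \<in> PGL2 q"

definition invariant_curve :: "nat \<Rightarrow> 'a::field poly3 \<Rightarrow> bool" where
  "invariant_curve q F \<longleftrightarrow> (\<forall>g \<in> PGL2 q. g ` curve_points F = curve_points F)"

definition hermitian3 :: "nat \<Rightarrow> 'a::field poly3" where
  "hermitian3 q = varY ^ (q + 1) - (varX ^ q * varZ + varX * varZ ^ q)"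

definition conic3 :: "'a::field poly3" where
  "conic3 = varY ^ 2 - 2 * varX * varZ"

end

theory Submission
  imports Defs "Berlekamp_Zassenhaus.Unique_Factorization_Poly"
begin

text \<open>By the Nullstellensatz for a prime F, invariance of the curve makes F a semi-invariant of each
generator. A nontrivial multiplier of one of the involutions would force F to vanish on its fixed line,
so after normalization F is invariant under the orthogonal group of the conic Q = Y^2 - 2XZ, and d is
even. Restricted to the conic, F becomes a binary form h of degree 2d invariant under PGL(2,q); since
d < q^2 - q, h is a multiple of an even power of y^q - y, that is, of the restriction of a power of
the Hermitian form U. Subtracting that power and dividing by Q gives an invariant of degree d - 2,
whence F is a combination of the U^i Q^j. Over an algebraically closed field this binary expression in
U and Q^((q+1)/2) has a linear factor, and F is irreducible.\<close>

section \<open>Polynomials as functions\<close>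

text \<open>The conic is parametrized by (y^2/2, y, 1), and on it the generators act by y + a, b y
  and 2/y. The classification of the restricted forms is a shadow of Dickson's theorem: the
  invariants of SL(2,q) on binary forms are generated by one of degree q + 1, dehomogenized to y^q -
  y, and one of degree q^2 - q. As the restriction of F has degree 2d, below d = q^2 - q the second
  generator can enter at most to the first power, and the scalings rule that out; its square would
  be admissible at d = q^2 - q, which explains the bound. Even powers of y^q - y lift to the plane
  because the Hermitian form restricts to -(y^q - y)^2/2. Substitution into nested polynomials is
  awkward to handle syntactically. Since K is infinite, polynomials are compared through their
  values: an identity is proved off a finite set of parameters and then extended.\<close>

lemma alg_closed_infinite:
  assumes "alg_closed TYPE('k::field)"
  shows "infinite (UNIV :: 'k set)"
proof
  assume fin: "finite (UNIV :: 'k set)"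
  define P :: "'k poly" where "P = (\<Prod>a\<in>UNIV. [:-a, 1:]) + 1"
  have "degree (\<Prod>a\<in>(UNIV :: 'k set). [:-a, 1:]) = card (UNIV :: 'k set)"
    by (subst degree_prod_eq_sum_degree) auto
  moreover have "card (UNIV :: 'k set) \<ge> 1"
    using fin by (simp add: Suc_le_eq card_gt_0_iff)
  ultimately have "degree P \<ge> 1"
    unfolding P_def by (subst degree_add_eq_left) auto
  then obtain x where "poly P x = 0"
    using assms unfolding alg_closed_def by blast
  moreover have "(\<Prod>a\<in>(UNIV :: 'k set). x - a) = 0"
    using fin by (subst prod_zero_iff) auto
  ultimately show False
    by (simp add: P_def poly_prod)
qed

lemma poly_eq_0_cofinite:
  fixes p :: "'k::idom poly"
  assumes "infinite (UNIV :: 'k set)" "finite S" "\<And>x. x \<notin> S \<Longrightarrow> poly p x = 0"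
  shows "p = 0"
proof (rule ccontr)
  assume "p \<noteq> 0"
  then have "finite ({x. poly p x = 0} \<union> S)"
    using assms poly_roots_finite by auto
  moreover have "{x. poly p x = 0} \<union> S = UNIV"
    using assms(3) by blast
  ultimately show False using assms(1) by simp
qed

text \<open>The outer variable is \<open>t\<close> because it will be the value of the conic: in
  \<open>pCons a H\<close> the coefficient \<open>a\<close> is then the restriction to the conic,
  and passing from \<open>pCons 0 H\<close> to \<open>H\<close> is division by the conic.\<close>

definition eval2 :: "'k::comm_ring_1 poly poly \<Rightarrow> 'k \<Rightarrow> 'k \<Rightarrow> 'k" where
  "eval2 H t y = poly (poly H [:t:]) y"

lemma eval2_simps [simp]:
  "eval2 0 t y = 0"
  "eval2 1 t y = 1"
  "eval2 (pCons a H) t y = poly a y + t * eval2 H t y"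
  "eval2 (G + H) t y = eval2 G t y + eval2 H t y"
  "eval2 (G - H) t y = eval2 G t y - eval2 H t y"
  "eval2 (G * H) t y = eval2 G t y * eval2 H t y"
  "eval2 (G ^ n) t y = eval2 G t y ^ n"
  "eval2 (smult p H) t y = poly p y * eval2 H t y"
  by (simp_all add: eval2_def)

lemma eval2_conv_poly: "eval2 H t y = poly (map_poly (\<lambda>p. poly p y) H) t"
  by (induction H) (auto simp: map_poly_pCons)

lemma eval2_eq_0:
  fixes H :: "'k::idom poly poly"
  assumes inf: "infinite (UNIV :: 'k set)" and H: "\<And>t y. eval2 H t y = 0"
  shows "H = 0"
proof (rule poly_eqI)
  fix i
  have "poly (coeff H i) y = 0" for y
  proof -
    have "map_poly (\<lambda>p. poly p y) H = 0"
      using inf H by (intro poly_eq_0_cofinite[of "{}"]) (auto simp flip: eval2_conv_poly)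
    then have "coeff (map_poly (\<lambda>p. poly p y) H) i = 0"
      by simp
    then show ?thesis
      by (simp add: coeff_map_poly)
  qed
  then have "coeff H i = 0"
    using inf by (intro poly_eq_0_cofinite[of "{}"]) auto
  then show "coeff H i = coeff 0 i"
    by simp
qed

lemma eval3_simps [simp]:
  "eval3 0 v = 0"
  "eval3 1 v = 1"
  "eval3 (F + G) v = eval3 F v + eval3 G v"
  "eval3 (F - G) v = eval3 F v - eval3 G v"
  "eval3 (- F) v = - eval3 F v"
  "eval3 (F * G) v = eval3 F v * eval3 G v"
  "eval3 (F ^ n) v = eval3 F v ^ n"
  "eval3 (const3 c) v = c"
  "eval3 varX v = fst v"
  "eval3 varY v = fst (snd v)"
  "eval3 varZ v = snd (snd v)"
  by (cases v; simp add: eval3_def const3_def varX_def varY_def varZ_def mono3_def poly_monom monom_0)+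

lemma eval3_numeral [simp]: "eval3 (numeral n) v = numeral n"
  by (cases v) (simp add: eval3_def)

lemma eval3_sum [simp]: "eval3 (sum f A) v = (\<Sum>i\<in>A. eval3 (f i) v)"
  by (induction A rule: infinite_finite_induct) auto

lemma eval3_pCons: "eval3 (pCons H F) (x, y, z) = eval2 H y x + z * eval3 F (x, y, z)"
  by (simp add: eval3_def eval2_def)

lemma eval3_conv_poly: "eval3 F (x, y, z) = poly (map_poly (\<lambda>H. eval2 H y x) F) z"
  by (induction F) (auto simp: map_poly_pCons eval3_pCons)

lemma eval3_hermitian3 [simp]:
  "eval3 (hermitian3 q) (x, y, z) = y ^ (q + 1) - (x ^ q * z + x * z ^ q)"
  by (simp add: hermitian3_def)

lemma eval3_conic3 [simp]: "eval3 conic3 (x, y, z) = y ^ 2 - 2 * x * z"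
  by (simp add: conic3_def)

lemma eval3_eq_0:
  fixes F :: "'k::idom poly3"
  assumes inf: "infinite (UNIV :: 'k set)" and F: "\<And>v. eval3 F v = 0"
  shows "F = 0"
proof (rule poly_eqI)
  fix i
  have "eval2 (coeff F i) y x = 0" for x y
  proof -
    have "map_poly (\<lambda>H. eval2 H y x) F = 0"
      using inf F by (intro poly_eq_0_cofinite[of "{}"]) (auto simp flip: eval3_conv_poly)
    then have "coeff (map_poly (\<lambda>H. eval2 H y x) F) i = 0"
      by simp
    then show ?thesis
      by (simp add: coeff_map_poly)
  qed
  then show "coeff F i = coeff 0 i"
    using inf by (simp add: eval2_eq_0)
qed

text \<open>\<open>R\<close> is a class of functions containing the constants and closed under sums
  and products. Taking for \<open>R\<close> the polynomial functions of one, two or three variables,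
  these closure lemmas provide substitution without an operation on nested polynomials.\<close>

lemma poly_closed:
  assumes "\<And>c. R (\<lambda>_. c)" "\<And>f g. R f \<Longrightarrow> R g \<Longrightarrow> R (\<lambda>s. f s + g s)"
    "\<And>f g. R f \<Longrightarrow> R g \<Longrightarrow> R (\<lambda>s. f s * g s)" "R f"
  shows "R (\<lambda>s. poly (p :: 'k::comm_ring_1 poly) (f s))"
  by (induction p) (auto intro!: assms)

lemma eval2_closed:
  assumes R: "\<And>c. R (\<lambda>_. c)" "\<And>f g. R f \<Longrightarrow> R g \<Longrightarrow> R (\<lambda>s. f s + g s)"
    "\<And>f g. R f \<Longrightarrow> R g \<Longrightarrow> R (\<lambda>s. f s * g s)" and "R f" "R g"
  shows "R (\<lambda>s. eval2 H (f s) (g s))"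
  by (induction H) (auto intro!: assms poly_closed[of R])

lemma eval3_closed:
  assumes R: "\<And>c. R (\<lambda>_. c)" "\<And>f g. R f \<Longrightarrow> R g \<Longrightarrow> R (\<lambda>s. f s + g s)"
    "\<And>f g. R f \<Longrightarrow> R g \<Longrightarrow> R (\<lambda>s. f s * g s)" and "R f" "R g" "R h"
  shows "R (\<lambda>s. eval3 F (f s, g s, h s))"
  by (induction F) (auto simp: eval3_pCons intro!: assms eval2_closed[of R])

definition poly_fun :: "('k::comm_ring_1 \<Rightarrow> 'k) \<Rightarrow> bool" where
  "poly_fun f \<longleftrightarrow> (\<exists>p. \<forall>s. f s = poly p s)"

lemma poly_fun_intros [intro]:
  fixes f g h :: "'k::comm_ring_1 \<Rightarrow> 'k"
  shows "poly_fun (\<lambda>_. c :: 'k)" "poly_fun (\<lambda>s. s :: 'k)"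
  "poly_fun f \<Longrightarrow> poly_fun g \<Longrightarrow> poly_fun (\<lambda>s. f s + g s)"
  "poly_fun f \<Longrightarrow> poly_fun g \<Longrightarrow> poly_fun (\<lambda>s. f s - g s)"
  "poly_fun f \<Longrightarrow> poly_fun g \<Longrightarrow> poly_fun (\<lambda>s. f s * g s)"
  "poly_fun f \<Longrightarrow> poly_fun (\<lambda>s. f s ^ n)"
  "poly_fun f \<Longrightarrow> poly_fun g \<Longrightarrow> poly_fun (\<lambda>s. eval2 H (f s) (g s))"
  "poly_fun f \<Longrightarrow> poly_fun g \<Longrightarrow> poly_fun h \<Longrightarrow> poly_fun (\<lambda>s. eval3 F (f s, g s, h s))"
proof -
  show const: "poly_fun (\<lambda>_. c)" for c :: 'k
    unfolding poly_fun_def by (rule exI[of _ "[:c:]"]) simp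
  show "poly_fun (\<lambda>s. s :: 'k)"
    unfolding poly_fun_def by (rule exI[of _ "[:0, 1:]"]) simp
  show add: "poly_fun (\<lambda>s. f s + g s)" if "poly_fun f" "poly_fun g" for f g :: "'k \<Rightarrow> 'k"
    using that unfolding poly_fun_def by (metis poly_add)
  show "poly_fun f \<Longrightarrow> poly_fun g \<Longrightarrow> poly_fun (\<lambda>s. f s - g s)"
    unfolding poly_fun_def by (metis poly_diff)
  show mult: "poly_fun (\<lambda>s. f s * g s)" if "poly_fun f" "poly_fun g" for f g :: "'k \<Rightarrow> 'k"
    using that unfolding poly_fun_def by (metis poly_mult)
  show "poly_fun f \<Longrightarrow> poly_fun (\<lambda>s. f s ^ n)"
    unfolding poly_fun_def by (metis poly_power)
  show "poly_fun f \<Longrightarrow> poly_fun g \<Longrightarrow> poly_fun (\<lambda>s. eval2 H (f s) (g s))"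
    by (rule eval2_closed[OF const add mult])
  show "poly_fun f \<Longrightarrow> poly_fun g \<Longrightarrow> poly_fun h \<Longrightarrow> poly_fun (\<lambda>s. eval3 F (f s, g s, h s))"
    by (rule eval3_closed[OF const add mult])
qed

lemma poly_fun_poly [intro]: "poly_fun (poly p)"
  by (auto simp: poly_fun_def)

text \<open>Zariski density on a line. It extends identities to the parameter values at which their
  proof divides by zero.\<close>

lemma poly_fun_eq_cofinite:
  fixes f g :: "'k::idom \<Rightarrow> 'k"
  assumes inf: "infinite (UNIV :: 'k set)" and fg: "poly_fun f" "poly_fun g"
    and S: "finite S" "\<And>s. s \<notin> S \<Longrightarrow> f s = g s"
  shows "f s = g s"
proof -
  obtain p q where pq: "\<And>s. f s = poly p s" "\<And>s. g s = poly q s"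
    using fg unfolding poly_fun_def by blast
  have "p - q = 0"
    using S pq by (intro poly_eq_0_cofinite[OF inf S(1)]) auto
  then show ?thesis
    using pq by simp
qed

lemma subst3_exists:
  "\<exists>G. \<forall>v. eval3 G v = eval3 F (eval3 A v, eval3 B v, eval3 C v)"
  by (rule eval3_closed[where R = "\<lambda>f. \<exists>G. \<forall>v. eval3 G v = f v"];
      metis eval3_simps)

text \<open>For \<open>c = 1 / 2\<close> the substituted point is the one on the chart Z = 1 that
  has second coordinate \<open>y\<close> and at which the conic takes the value
  \<open>t\<close>.\<close>

lemma subst_affine_exists:
  fixes F :: "'k::comm_ring_1 poly3"
  shows "\<exists>H. \<forall>t y. eval2 H t y = eval3 F (c * (y ^ 2 - t), y, 1)"
proof -
  let ?R = "\<lambda>f. \<exists>H :: 'k poly poly. \<forall>s. eval2 H (fst s) (snd s) = f s"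
  have const: "?R (\<lambda>_. a)" for a
    by (rule exI[of _ "[:[:a:]:]"]) simp
  have "?R (\<lambda>s. eval3 F (c * (snd s ^ 2 - fst s), snd s, 1))"
  proof (rule eval3_closed[where R = ?R])
    show "?R (\<lambda>s. c * (snd s ^ 2 - fst s))"
      by (rule exI[of _ "[:[:0, 0, c:], [:-c:]:]"]) (simp add: algebra_simps power2_eq_square)
    show "?R (\<lambda>s. snd s)"
      by (rule exI[of _ "[:[:0, 1:]:]"]) simp
  qed (use const in \<open>metis eval2_simps\<close>)+
  then show ?thesis
    by (metis fst_conv snd_conv)
qed

lemma eval3_scale_homogeneous:
  assumes "homogeneous3 F d"
  shows "eval3 F (s * x, s * y, s * z) = s ^ d * eval3 F (x, y, z)"
proof -
  have eval: "eval3 F (x, y, z) =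
      (\<Sum>k\<le>degree F. \<Sum>j\<le>degree (coeff F k). \<Sum>i\<le>degree (coeff (coeff F k) j).
        coeff3 F i j k * x ^ i * y ^ j * z ^ k)" for x y z
  proof -
    have "eval2 (coeff F k) y x = (\<Sum>j\<le>degree (coeff F k). poly (coeff (coeff F k) j) x * y ^ j)" for k
      by (simp add: eval2_def poly_altdef[of "coeff F k"] poly_sum poly_const_pow mult_ac)
    moreover have "eval3 F (x, y, z) = (\<Sum>k\<le>degree F. eval2 (coeff F k) y x * z ^ k)"
      by (simp add: eval3_def eval2_def poly_altdef[of F] poly_sum poly_const_pow mult_ac)
    ultimately show ?thesis
      by (simp add: poly_altdef coeff3_def sum_distrib_right sum_distrib_left mult_ac)
  qed
  have "coeff3 F i j k * (s * x) ^ i * (s * y) ^ j * (s * z) ^ k =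
      s ^ d * (coeff3 F i j k * x ^ i * y ^ j * z ^ k)" for i j k
  proof (cases "coeff3 F i j k = 0")
    case False
    then have "d = i + j + k"
      using assms by (auto simp: homogeneous3_def)
    then show ?thesis
      by (simp add: power_add power_mult_distrib mult_ac)
  qed simp
  then show ?thesis
    by (simp add: eval sum_distrib_left)
qed

section \<open>Vanishing on an irreducible curve\<close>

text \<open>Over the fraction field of the coefficients this is the Bezout identity of two coprime
  polynomials with its denominators cleared. To stay inside the ring, an element \<open>D\<close> of
  least degree in the ideal of \<open>F\<close> and \<open>G\<close> is chosen and division is
  replaced by pseudo-division, whence the factors \<open>c\<close>.\<close>

lemma ideal_contains_constant:
  fixes F G :: "'a::ufd poly"
  assumes irr: "irreducible F" and deg: "degree F \<ge> 1" and ndvd: "\<not> F dvd G"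
  shows "\<exists>A B r. r \<noteq> 0 \<and> A * F + B * G = [:r:]"
proof -
  have prime: "prime_elem F"
    using irr by (rule iffD2[OF prime_elem_iff_irreducible])
  have F0: "F \<noteq> 0"
    using deg by auto
  define I where "I = {A * F + B * G | A B. True}"
  have I_F: "F \<in> I" and I_G: "G \<in> I"
  proof -
    have "F = 1 * F + 0 * G" "G = 0 * F + 1 * G"
      by simp_all
    then show "F \<in> I" "G \<in> I"
      unfolding I_def by blast+
  qed
  have I_diff: "smult c E - D * Q \<in> I" if ED: "E \<in> I" "D \<in> I" for c E D Q
  proof -
    obtain A B A' B' where "E = A * F + B * G" "D = A' * F + B' * G"
      using ED unfolding I_def by blast
    then have "smult c E - D * Q = (smult c A - A' * Q) * F + (smult c B - B' * Q) * G"
      by (simp add: algebra_simps smult_add_right)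
    then show ?thesis
      unfolding I_def by blast
  qed
  obtain D where D: "D \<in> I" "D \<noteq> 0"
    and D_min: "\<And>E. E \<in> I \<Longrightarrow> E \<noteq> 0 \<Longrightarrow> degree D \<le> degree E"
    using ex_has_least_nat[of "\<lambda>D. D \<in> I \<and> D \<noteq> 0" F degree] I_F F0 by blast
  have D_dvd: "\<exists>c Q. c \<noteq> 0 \<and> smult c E = D * Q" if "E \<in> I" for E
  proof -
    obtain Q S where QS: "pseudo_divmod E D = (Q, S)"
      by force
    define c where "c = lead_coeff D ^ (Suc (degree E) - degree D)"
    have eq: "smult c E = D * Q + S"
      unfolding c_def using pseudo_divmod(1)[OF D(2) QS] .
    then have "S \<in> I"
      using I_diff[OF that D(1), of c Q] by simp
    then have "S = 0"
      using pseudo_divmod(2)[OF D(2) QS] D_min[of S] by fastforce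
    moreover have "c \<noteq> 0"
      using D(2) by (simp add: c_def)
    ultimately show ?thesis
      using eq by (metis add.right_neutral)
  qed
  \<comment> \<open>Up to nonzero constants, D divides F and G. If D were nonconstant, primality of F would force
    F to divide D, hence G, or D to be a constant.\<close>
  have "degree D = 0"
  proof (rule ccontr)
    assume degD: "degree D \<noteq> 0"
    obtain c Q where cQ: "c \<noteq> 0" "smult c F = D * Q"
      using D_dvd[OF I_F] by blast
    have "F dvd smult c F"
      by (rule dvd_smult) simp
    then have "F dvd D * Q"
      unfolding cQ(2) .
    then consider "F dvd D" | "F dvd Q"
      using prime_elem_dvd_multD[OF prime] by blast
    then show False
    proof cases
      case 1
      obtain e S where eS: "e \<noteq> 0" "smult e G = D * S"
        using D_dvd[OF I_G] by blast
      have "F dvd D * S"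
        using 1 by (rule dvd_mult2)
      also have "D * S = [:e:] * G"
        using eS(2) by simp
      finally have "F dvd [:e:] * G" .
      then have "F dvd [:e:]"
        using prime_elem_dvd_multD[OF prime] ndvd by blast
      then show False
        using dvd_imp_degree_le[of F "[:e:]"] eS(1) deg by simp
    next
      case 2
      then obtain W where "Q = F * W"
        by (elim dvdE)
      then have "smult c F = F * (D * W)"
        using cQ by (simp add: mult_ac)
      then have "F * [:c:] = F * (D * W)"
        by simp
      then have eq: "D * W = [:c:]"
        using F0 by (subst (asm) mult_left_cancel) simp_all
      then have "D \<noteq> 0" "W \<noteq> 0"
        using cQ(1) by auto
      then have "degree (D * W) = degree D + degree W"
        by (rule degree_mult_eq)
      then show False
        using degD unfolding eq by simp
    qed
  qed
  then obtain r where "D = [:r:]"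
    by (metis degree_eq_zeroE)
  then show ?thesis
    using D unfolding I_def by fastforce
qed

text \<open>Otherwise some combination of \<open>F\<close> and \<open>G\<close> is a nonzero
  \<open>r\<close> free of Z. Above a point of the (X, Y)-plane where neither \<open>r\<close> nor
  the leading coefficient of \<open>F\<close> vanishes, \<open>F\<close> has a zero; there
  \<open>G\<close> vanishes too, but \<open>r\<close> does not.\<close>

lemma irreducible_dvd_if_vanishes:
  fixes F G :: "'k::field poly3"
  assumes ac: "alg_closed TYPE('k)" and irr: "irreducible F" and deg: "degree F \<ge> 1"
    and van: "\<And>v. eval3 F v = 0 \<Longrightarrow> eval3 G v = 0"
  shows "F dvd G"
proof (rule ccontr)
  assume "\<not> F dvd G"
  then obtain A B r where r: "r \<noteq> 0" and AB: "A * F + B * G = [:r:]"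
    using ideal_contains_constant[OF irr deg] by blast
  have inf: "infinite (UNIV :: 'k set)"
    using ac by (rule alg_closed_infinite)
  have "r * lead_coeff F \<noteq> 0"
    using r deg by auto
  then obtain y x where "eval2 (r * lead_coeff F) y x \<noteq> 0"
    using eval2_eq_0[OF inf] by blast
  then have r': "eval2 r y x \<noteq> 0" and lc: "eval2 (lead_coeff F) y x \<noteq> 0"
    by auto
  let ?f = "map_poly (\<lambda>H. eval2 H y x) F"
  have "coeff ?f (degree F) \<noteq> 0"
    using lc by (simp add: coeff_map_poly)
  then have "degree ?f \<ge> 1"
    using deg le_degree order_trans by blast
  then obtain z where "poly ?f z = 0"
    using ac unfolding alg_closed_def by blast
  then have F0: "eval3 F (x, y, z) = 0"
    by (simp add: eval3_conv_poly)
  then have "eval3 (A * F + B * G) (x, y, z) = 0"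
    using van by simp
  then show False
    using AB r' by (simp add: eval3_pCons)
qed

section \<open>Multipliers of the generators\<close>

lemma poly3_unit_const:
  fixes U :: "'k::field poly3"
  assumes "U dvd 1"
  shows "\<exists>c. c \<noteq> 0 \<and> U = const3 c"
proof -
  obtain V where V: "U = [:V:]" "V dvd 1"
    using iffD1[OF is_unit_poly_iff assms] by blast
  obtain W where W: "V = [:W:]" "W dvd 1"
    using iffD1[OF is_unit_poly_iff V(2)] by blast
  obtain c where "W = [:c:]" "c dvd 1"
    using iffD1[OF is_unit_poly_iff W(2)] by blast
  then show ?thesis
    using V(1) W(1) by (intro exI[of _ c]) (auto simp: const3_def mono3_def monom_0)
qed

text \<open>The zero \<open>v\<close> certifies that \<open>l\<close> is not a unit, so the cofactor
  is one, that is, a nonzero constant.\<close>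

lemma irreducible_factor_proportional:
  fixes F :: "'k::field poly3"
  assumes irr: "irreducible F" and dvd: "l dvd F" and zero: "eval3 l v = 0"
  shows "\<exists>c. c \<noteq> 0 \<and> F = const3 c * l"
proof -
  obtain U where U: "F = l * U"
    using dvd by (elim dvdE)
  have "\<not> l dvd 1"
  proof
    assume "l dvd 1"
    then obtain W where "1 = l * W"
      by (elim dvdE)
    then have "eval3 (1 :: 'k poly3) v = eval3 (l * W) v"
      by simp
    then show False
      using zero by simp
  qed
  then have "U dvd 1"
    using irr U by (auto dest: irreducibleD)
  then show ?thesis
    using poly3_unit_const[of U] U by (auto simp: mult.commute)
qed

text \<open>\<open>F\<close> is a constant times \<open>l\<close>, so its values scale by both s^d
  and s^e, and an infinite field separates the exponents. It serves to exclude lines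
  (\<open>e = 1\<close>) and the conic (\<open>e = 2\<close>) as factors.\<close>

lemma irreducible_factor_degree:
  fixes F :: "'k::field poly3"
  assumes inf: "infinite (UNIV :: 'k set)" and irr: "irreducible F" and hom: "homogeneous3 F d"
    and dvd: "l dvd F" and zero: "eval3 l v = 0"
    and l: "\<And>s x y z. eval3 l (s * x, s * y, s * z) = s ^ e * eval3 l (x, y, z)"
  shows "d = e"
proof -
  obtain c where c: "c \<noteq> 0" "F = const3 c * l"
    using irreducible_factor_proportional[OF irr dvd zero] by blast
  have "F \<noteq> 0"
    using irr by auto
  then obtain x y z where xyz: "eval3 F (x, y, z) \<noteq> 0"
    using eval3_eq_0[OF inf] by (metis prod_cases3)
  have "s ^ d = s ^ e" for s :: 'k
  proof -
    have "s ^ d * eval3 F (x, y, z) = c * (s ^ e * eval3 l (x, y, z))"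
      unfolding eval3_scale_homogeneous[OF hom, symmetric] by (simp add: c l)
    also have "\<dots> = s ^ e * eval3 F (x, y, z)"
      by (simp add: c)
    finally show ?thesis
      using xyz by simp
  qed
  then have "monom 1 d - monom 1 e = (0 :: 'k poly)"
    by (intro poly_eq_0_cofinite[OF inf, of "{}"]) (auto simp: poly_monom)
  then have "monom 1 d = (monom 1 e :: 'k poly)"
    by simp
  then have "degree (monom 1 d :: 'k poly) = degree (monom 1 e :: 'k poly)"
    by (rule arg_cong)
  then show ?thesis
    by (simp add: degree_monom_eq)
qed

text \<open>The form Z - bX is monic in the outermost variable, so the factor theorem over the
  polynomials in X and Y makes it a divisor of \<open>F\<close>.\<close>

lemma irreducible_line_Z:
  fixes F :: "'k::field poly3"
  assumes inf: "infinite (UNIV :: 'k set)" and irr: "irreducible F" and hom: "homogeneous3 F d"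
    and van: "\<And>x y. eval3 F (x, y, b * x) = 0"
  shows "d = 1"
proof -
  let ?B = "[:[:0, b:]:] :: 'k poly poly"
  have "eval2 (poly G H) y x = eval3 G (x, y, eval2 H y x)" for G :: "'k poly3" and H x y
    by (induction G) (auto simp: eval3_pCons)
  then have "eval2 (poly F ?B) y x = 0" for y x
    using van[of x y] by (simp add: mult.commute)
  then have "poly F ?B = 0"
    by (rule eval2_eq_0[OF inf])
  define l where "l = [:- ?B, 1:]"
  have dvd: "l dvd F"
    using \<open>poly F ?B = 0\<close> by (simp only: poly_eq_0_iff_dvd l_def)
  have ev: "eval3 l (x, y, z) = z - b * x" for x y z
    by (simp add: eval3_pCons eval2_def l_def)
  show ?thesis
    by (rule irreducible_factor_degree[OF inf irr hom dvd, of "(0, 0, 0)"])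
      (simp_all add: ev algebra_simps)
qed

text \<open>Y lives in the coefficients, so divisibility by it is tested on each coefficient of
  \<open>F\<close> as a polynomial in Z.\<close>

lemma irreducible_line_Y:
  fixes F :: "'k::field poly3"
  assumes inf: "infinite (UNIV :: 'k set)" and irr: "irreducible F" and hom: "homogeneous3 F d"
    and van: "\<And>x z. eval3 F (x, 0, z) = 0"
  shows "d = 1"
proof -
  define l where "l = ([:[:0, 1:]:] :: 'k poly3)"
  have "[:0, 1:] dvd coeff F k" for k
  proof -
    have "poly (poly (coeff F k) 0) x = 0" for x
    proof -
      have "map_poly (\<lambda>H. eval2 H 0 x) F = 0"
        using van by (intro poly_eq_0_cofinite[OF inf, of "{}"]) (auto simp flip: eval3_conv_poly)
      then have "coeff (map_poly (\<lambda>H. eval2 H 0 x) F) k = 0"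
        by simp
      then show ?thesis
        by (simp add: coeff_map_poly eval2_def)
    qed
    then have "poly (coeff F k) 0 = 0"
      by (intro poly_eq_0_cofinite[OF inf, of "{}"]) auto
    then show ?thesis
      using poly_eq_0_iff_dvd[of "coeff F k" 0] by simp
  qed
  then have dvd: "l dvd F"
    by (simp add: const_poly_dvd_iff l_def)
  have ev: "eval3 l (x, y, z) = y" for x y z
    by (simp add: eval3_pCons l_def)
  show ?thesis
    by (rule irreducible_factor_degree[OF inf irr hom dvd, of "(0, 0, 0)"])
      (simp_all add: ev)
qed

text \<open>\<open>F\<close> composed with \<open>g\<close> vanishes on the curve, hence is
  \<open>F * H\<close>. As \<open>g\<close> commutes with scaling, both \<open>F\<close> and
  \<open>F * H\<close> scale by s^d, so \<open>H\<close> is constant along each punctured line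
  through the origin and takes its value at the origin everywhere.\<close>

lemma semi_invariant:
  fixes F :: "'k::field poly3"
  assumes ac: "alg_closed TYPE('k)" and irr: "irreducible F" and deg: "degree F \<ge> 1"
    and hom: "homogeneous3 F d"
    and g: "\<And>v. g v = (eval3 A v, eval3 B v, eval3 C v)"
    and lin: "\<And>s x y z. g (s * x, s * y, s * z) = (case g (x, y, z) of (x', y', z') \<Rightarrow> (s * x', s * y', s * z'))"
    and van: "\<And>v. eval3 F v = 0 \<Longrightarrow> eval3 F (g v) = 0"
  shows "\<exists>c. \<forall>v. eval3 F (g v) = c * eval3 F v"
proof -
  have inf: "infinite (UNIV :: 'k set)"
    using ac by (rule alg_closed_infinite)
  have F0: "F \<noteq> 0"
    using deg by auto
  obtain G where G: "\<And>v. eval3 G v = eval3 F (g v)"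
    using subst3_exists[of F A B C] g by auto
  have "F dvd G"
    using van by (intro irreducible_dvd_if_vanishes[OF ac irr deg]) (simp add: G)
  then obtain H where H: "G = F * H"
    by (elim dvdE)
  have scale: "eval3 H (s * x, s * y, s * z) = eval3 H (x, y, z)" if "s \<noteq> 0" for s x y z
  proof -
    obtain K where "\<forall>v. eval3 K v =
        eval3 H (eval3 (const3 s * varX) v, eval3 (const3 s * varY) v, eval3 (const3 s * varZ) v)"
      using subst3_exists by blast
    then have K: "eval3 K (x, y, z) = eval3 H (s * x, s * y, s * z)" for x y z
      by simp
    \<comment> \<open>The values of \<open>F\<close> may be zero, so \<open>F\<close> is kept as a
      factor and cancelled only in the polynomial ring, which is a domain.\<close>
    have "eval3 (F * (K - H)) (x, y, z) = 0" for x y z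
    proof -
      obtain x' y' z' where g': "g (x, y, z) = (x', y', z')"
        by (metis prod_cases3)
      have "s ^ d * eval3 F (x, y, z) * eval3 H (s * x, s * y, s * z) = eval3 G (s * x, s * y, s * z)"
        unfolding H by (simp add: eval3_scale_homogeneous[OF hom])
      also have "\<dots> = s ^ d * eval3 G (x, y, z)"
        by (simp add: G lin g' eval3_scale_homogeneous[OF hom])
      also have "\<dots> = s ^ d * eval3 F (x, y, z) * eval3 H (x, y, z)"
        by (simp add: H)
      finally have "eval3 F (x, y, z) * eval3 H (s * x, s * y, s * z) = eval3 F (x, y, z) * eval3 H (x, y, z)"
        using that by simp
      then show ?thesis
        by (simp add: K algebra_simps)
    qed
    then have "F * (K - H) = 0"
      by (intro eval3_eq_0[OF inf]) (metis prod_cases3)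
    then have "K = H"
      using F0 by simp
    then show ?thesis
      using K by simp
  qed
  have "eval3 H (x, y, z) = eval3 H (0, 0, 0)" for x y z
  proof -
    have "eval3 H (s * x, s * y, s * z) = eval3 H (x, y, z)" for s
      by (rule poly_fun_eq_cofinite[OF inf, of "\<lambda>s. eval3 H (s * x, s * y, s * z)" _ "{0}"])
        (auto simp: scale intro!: poly_fun_intros)
    from this[of 0] show ?thesis
      by simp
  qed
  then have "eval3 F (g v) = eval3 H (0, 0, 0) * eval3 F v" for v
    unfolding G[symmetric] H by (cases v) (simp add: mult.commute)
  then show ?thesis
    by blast
qed

lemma PGL2_generators:
  "gen_swap \<in> PGL2 q"
  "a \<in> Fq q \<Longrightarrow> gen_trans a \<in> PGL2 q"
  "b \<in> Fq q \<Longrightarrow> b \<noteq> 0 \<Longrightarrow> gen_scale b \<in> PGL2 q"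
  using PGL2_swap[OF PGL2_id] PGL2_trans[OF _ PGL2_id] PGL2_scale[OF _ _ PGL2_id] by auto

text \<open>\<open>curve_points\<close> lives in the punctured cone, so the origin is treated apart
  through \<open>g0\<close>.\<close>

lemma invariant_curve_vanishes:
  assumes inv: "invariant_curve q F" and g: "g \<in> PGL2 q" and F: "eval3 F v = 0"
    and g0: "g (0, 0, 0) = (0, 0, 0)"
  shows "eval3 F (g v) = 0"
proof (cases "v = (0, 0, 0)")
  case True
  then show ?thesis
    using F g0 by simp
next
  case False
  then have "v \<in> curve_points F"
    using F by (simp add: curve_points_def)
  then have "g v \<in> curve_points F"
    using inv g unfolding invariant_curve_def by blast
  then show ?thesis
    by (simp add: curve_points_def)
qed

text \<open>The divisibility criterion needs Z to occur in \<open>F\<close>. A curve whose equation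
  is free of Z is a cone with vertex (0, 0, 1); the swap puts (1, 0, 0) on it, hence the whole line
  Y = 0.\<close>

lemma invariant_curve_degree_Z:
  fixes F :: "'k::field poly3"
  assumes inf: "infinite (UNIV :: 'k set)" and irr: "irreducible F" and hom: "homogeneous3 F d"
    and inv: "invariant_curve q F" and d: "d > 1"
  shows "degree F \<ge> 1"
proof (rule ccontr)
  assume "\<not> ?thesis"
  then obtain H where H: "F = [:H:]"
    by (metis degree_eq_zeroE less_one linorder_not_le)
  then have ev: "eval3 F (x, y, z) = eval3 F (x, y, 0)" for x y z
    by (simp add: eval3_pCons)
  have "eval3 F (0, 0, 0) = 0"
    using eval3_scale_homogeneous[OF hom, of 0 0 0 0] d by (auto simp: power_0_left)
  then have "eval3 F (0, 0, 1) = 0"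
    using ev[of 0 0 1] by simp
  then have "eval3 F (gen_swap (0, 0, 1)) = 0"
    by (rule invariant_curve_vanishes[OF inv PGL2_generators(1)]) (simp add: gen_swap_def)
  then have "eval3 F (x, 0, z) = 0" for x z
    using ev[of x 0 z] eval3_scale_homogeneous[OF hom, of x 1 0 0] by (simp add: gen_swap_def)
  then have "d = 1"
    by (rule irreducible_line_Y[OF inf irr hom])
  then show False
    using d by simp
qed

lemma Fq_neg: "odd q \<Longrightarrow> b \<in> Fq q \<Longrightarrow> - b \<in> Fq q"
  by (simp add: Fq_def)

lemma one_in_Fq: "1 \<in> Fq q"
  by (simp add: Fq_def)

lemma CHAR_odd_two_neq_0:
  assumes "CHAR('k::field) = p" "prime p" "odd p"
  shows "(2 :: 'k) \<noteq> 0"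
proof
  assume "(2 :: 'k) = 0"
  then have "of_nat 2 = (0 :: 'k)"
    by simp
  then have "p dvd 2"
    using assms(1) of_nat_eq_0_iff_char_dvd by blast
  then show False
    using assms(2,3) primes_dvd_imp_eq two_is_prime_nat by blast
qed

text \<open>Translations compose additively, so the \<open>p\<close>-th iterate is the identity and
  \<open>c ^ p = 1\<close>; characteristic \<open>p\<close> has no other \<open>p\<close>-th root of
  unity than 1.\<close>

lemma trans_multiplier:
  fixes F :: "'k::field poly3"
  assumes char: "CHAR('k) = p" "prime p" "odd p" and F: "eval3 F v0 \<noteq> 0"
    and c: "\<And>v. eval3 F (gen_trans a v) = c * eval3 F v"
  shows "c = 1"
proof -
  have two: "(2 :: 'k) \<noteq> 0"
    using CHAR_odd_two_neq_0[OF char] .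
  then have "(2 :: 'k) * 2 \<noteq> 0"
    by (metis mult_eq_0_iff)
  then have "gen_trans a (gen_trans (of_nat k * a) v) = gen_trans (of_nat (Suc k) * a) v" for k v
    using two
    by (cases v) (simp add: gen_trans_def field_simps power2_eq_square)
  then have "eval3 F (gen_trans (of_nat k * a) v) = c ^ k * eval3 F v" for k v
  proof (induction k)
    case 0
    then show ?case
      by (cases v) (simp add: gen_trans_def)
  next
    case (Suc k)
    then show ?case
      using c[of "gen_trans (of_nat k * a) v"] by simp
  qed
  from this[of p v0] have "eval3 F v0 = c ^ p * eval3 F v0"
    using char(1) by (cases v0) (auto simp: gen_trans_def)
  then have "c ^ p = 1"
    using F by simp
  moreover have "((c - 1) + 1) ^ p = (c - 1) ^ p + 1 ^ p"
    using char by (intro freshmans_dream) auto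
  ultimately have "(c - 1) ^ p = 0"
    by simp
  then show ?thesis
    by simp
qed

text \<open>The scaling diag(b^2, b, 1) is b times the isometry diag(b, 1, 1/b) of the conic, so the
  multiplier \<open>b ^ d\<close> expresses invariance under that isometry.\<close>

lemma invariant_curve_normalized:
  fixes F :: "'k::field poly3"
  assumes ac: "alg_closed TYPE('k)" and irr: "irreducible F" and hom: "homogeneous3 F d"
    and inv: "invariant_curve q F" and d: "d > 1"
    and char: "CHAR('k) = p" "prime p" "odd p" and q: "odd q"
  shows "even d"
    and "\<And>x y z. eval3 F (z, y, x) = eval3 F (x, y, z)"
    and "\<And>a x y z. a \<in> Fq q \<Longrightarrow> eval3 F (x + a * y + a ^ 2 / 2 * z, y + a * z, z) = eval3 F (x, y, z)"
    and "\<And>b x y z. b \<in> Fq q \<Longrightarrow> b \<noteq> 0 \<Longrightarrow> eval3 F (b ^ 2 * x, b * y, z) = b ^ d * eval3 F (x, y, z)"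
proof -
  have inf: "infinite (UNIV :: 'k set)"
    using ac by (rule alg_closed_infinite)
  have two: "(2 :: 'k) \<noteq> 0"
    using CHAR_odd_two_neq_0[OF char] .
  have deg: "degree F \<ge> 1"
    by (rule invariant_curve_degree_Z[OF inf irr hom inv d])
  have "F \<noteq> 0"
    using irr by auto
  then obtain x0 y0 z0 where F0: "eval3 F (x0, y0, z0) \<noteq> 0"
    using eval3_eq_0[OF inf] by (metis prod_cases3)
  have "\<exists>c. \<forall>v. eval3 F (gen_swap v) = c * eval3 F v"
  proof (rule semi_invariant[OF ac irr deg hom, of _ varZ varY varX])
    show "eval3 F (gen_swap v) = 0" if "eval3 F v = 0" for v
      by (rule invariant_curve_vanishes[OF inv PGL2_generators(1) that]) (simp add: gen_swap_def)
  qed (auto simp: gen_swap_def)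
  then obtain \<sigma> where \<sigma>: "\<And>x y z. eval3 F (z, y, x) = \<sigma> * eval3 F (x, y, z)"
    by (auto simp: gen_swap_def)
  show "eval3 F (x + a * y + a ^ 2 / 2 * z, y + a * z, z) = eval3 F (x, y, z)" if a: "a \<in> Fq q" for a x y z
  proof -
    have "\<exists>c. \<forall>v. eval3 F (gen_trans a v) = c * eval3 F v"
    proof (rule semi_invariant[OF ac irr deg hom, of _ "varX + const3 a * varY + const3 (a ^ 2 / 2) * varZ"
            "varY + const3 a * varZ" varZ])
      show "eval3 F (gen_trans a v) = 0" if "eval3 F v = 0" for v
        by (rule invariant_curve_vanishes[OF inv PGL2_generators(2)[OF a] that]) (simp add: gen_trans_def)
    qed (auto simp: gen_trans_def algebra_simps)
    then obtain c where c: "\<And>v. eval3 F (gen_trans a v) = c * eval3 F v"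
      by blast
    then have "c = 1"
      by (rule trans_multiplier[OF char F0])
    then show ?thesis
      using c[of "(x, y, z)"] by (simp add: gen_trans_def)
  qed
  have scale: "\<exists>c. (\<forall>x y z. eval3 F (b ^ 2 * x, b * y, z) = c * eval3 F (x, y, z)) \<and> \<sigma> * c = b ^ d"
    if b: "b \<in> Fq q" "b \<noteq> 0" for b
  proof -
    have "\<exists>c. \<forall>v. eval3 F (gen_scale b v) = c * eval3 F v"
    proof (rule semi_invariant[OF ac irr deg hom, of _ "const3 (b ^ 2) * varX" "const3 b * varY" varZ])
      show "eval3 F (gen_scale b v) = 0" if "eval3 F v = 0" for v
        by (rule invariant_curve_vanishes[OF inv PGL2_generators(3)[OF b] that]) (simp add: gen_scale_def)
    qed (auto simp: gen_scale_def)
    then obtain c where c: "\<And>x y z. eval3 F (b ^ 2 * x, b * y, z) = c * eval3 F (x, y, z)"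
      by (force simp: gen_scale_def)
    \<comment> \<open>The map w composed of scaling and swap has the square b^2 id and fixes the plane z = b x up to
      the factor b, so the multiplier of w is b^d or F vanishes on that plane.\<close>
    have w: "eval3 F (z, b * y, b ^ 2 * x) = \<sigma> * c * eval3 F (x, y, z)" for x y z
      by (simp add: \<sigma>[of z "b * y"] c)
    have "(\<sigma> * c) ^ 2 * eval3 F (x0, y0, z0) = eval3 F (b ^ 2 * x0, b * (b * y0), b ^ 2 * z0)"
      by (simp add: w power2_eq_square[of "\<sigma> * c"] mult.assoc)
    also have "\<dots> = (b ^ 2) ^ d * eval3 F (x0, y0, z0)"
      using eval3_scale_homogeneous[OF hom, of "b ^ 2" x0 y0 z0] by (simp add: power2_eq_square mult.assoc)
    finally have "(\<sigma> * c) ^ 2 = (b ^ d) ^ 2"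
      using F0 by (simp add: mult.commute flip: power_mult)
    then consider "\<sigma> * c = b ^ d" | "\<sigma> * c = - (b ^ d)"
      using power2_eq_iff by blast
    then have "\<sigma> * c = b ^ d"
    proof cases
      case 2
      have "eval3 F (x, y, b * x) = 0" for x y
      proof -
        have "b ^ d * eval3 F (x, y, b * x) = eval3 F (b * x, b * y, b ^ 2 * x)"
          using eval3_scale_homogeneous[OF hom, of b x y "b * x"] by (simp add: power2_eq_square mult.assoc)
        also have "\<dots> = - (b ^ d) * eval3 F (x, y, b * x)"
          by (simp only: w 2)
        finally have "2 * (b ^ d * eval3 F (x, y, b * x)) = 0"
          by simp
        then show ?thesis
          using two b by simp
      qed
      then have "d = 1"
        by (rule irreducible_line_Z[OF inf irr hom])
      then show ?thesis
        using d by simp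
    qed
    then show ?thesis
      using c by blast
  qed
  \<comment> \<open>So far only the product of the multipliers of swap and scaling is known. For b =
    1 the scaling is the identity with multiplier 1, and the product relation yields the multiplier
    \<open>\<sigma>\<close> of the swap.\<close>
  obtain c where c: "\<And>x y z. eval3 F (x, y, z) = c * eval3 F (x, y, z)" "\<sigma> * c = 1"
    using scale[OF one_in_Fq] by auto
  have "c = 1"
    using c(1)[of x0 y0 z0] F0 by simp
  then have \<sigma>1: "\<sigma> = 1"
    using c(2) by simp
  show "eval3 F (z, y, x) = eval3 F (x, y, z)" for x y z
    using \<sigma>[of z y x] \<sigma>1 by simp
  show scale': "eval3 F (b ^ 2 * x, b * y, z) = b ^ d * eval3 F (x, y, z)"
    if "b \<in> Fq q" "b \<noteq> 0" for b x y z
    using scale[OF that] \<sigma>1 by auto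
  \<comment> \<open>The scaling by b = -1 is the reflection in the line Y = 0. If \<open>d\<close>
    were odd it would change the sign of \<open>F\<close>, and \<open>F\<close> would vanish on that
    line.\<close>
  show "even d"
  proof (rule ccontr)
    assume "odd d"
    then have "eval3 F (x, - y, z) = - eval3 F (x, y, z)" for x y z
      using scale'[of "-1" x y z] Fq_neg[OF q one_in_Fq] by simp
    from this[of _ 0] have "2 * eval3 F (x, 0, z) = 0" for x z
      by (metis add.right_inverse minus_zero mult_2)
    then have "eval3 F (x, 0, z) = 0" for x z
      using two by simp
    then have "d = 1"
      by (rule irreducible_line_Y[OF inf irr hom])
    then show False
      using d by simp
  qed
qed

section \<open>Binary invariants\<close>

lemma prod_linear_factors_dvd:
  fixes p :: "'a::idom poly"
  assumes "finite A" "\<And>a. a \<in> A \<Longrightarrow> poly p a = 0"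
  shows "(\<Prod>a\<in>A. [:-a, 1:]) dvd p"
  using assms
proof (induction A rule: finite_induct)
  case (insert a A)
  then obtain r where r: "p = (\<Prod>a\<in>A. [:-a, 1:]) * r"
    by (auto elim: dvdE)
  have "(\<Prod>x\<in>A. a - x) \<noteq> 0"
    using insert by auto
  then have "poly r a = 0"
    using insert.prems[of a] by (simp add: r poly_prod)
  then obtain s where s: "r = [:-a, 1:] * s"
    by (auto simp: poly_eq_0_iff_dvd elim: dvdE)
  have "p = (\<Prod>a\<in>insert a A. [:-a, 1:]) * s"
    by (simp only: r s prod.insert[OF insert.hyps(1,2)] mult_ac)
  then show ?case
    by (rule dvdI)
qed simp

text \<open>Its zeros are the elements of \<open>Fq q\<close>, and for \<open>q\<close> a power of
  the characteristic it is additive, hence invariant under the translations by its zeros.\<close>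

definition artin_schreier :: "nat \<Rightarrow> 'k::field poly" where
  "artin_schreier q = monom 1 q - monom 1 1"

lemma poly_artin_schreier [simp]: "poly (artin_schreier q) y = y ^ q - y"
  by (simp add: artin_schreier_def poly_monom)

lemma degree_artin_schreier: "q \<ge> 2 \<Longrightarrow> degree (artin_schreier q :: 'k::field poly) = q"
  unfolding artin_schreier_def
  by (subst diff_conv_add_uminus, subst degree_add_eq_left) (simp_all add: degree_monom_eq)

lemma lead_coeff_artin_schreier: "q \<ge> 2 \<Longrightarrow> lead_coeff (artin_schreier q :: 'k::field poly) = 1"
  by (simp add: degree_artin_schreier) (simp add: artin_schreier_def)

lemma finite_Fq:
  assumes "q \<ge> 2"
  shows "finite (Fq q :: 'k::field set)"
proof -
  have "artin_schreier q \<noteq> (0 :: 'k poly)"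
    using degree_artin_schreier[OF assms, where 'k = 'k] assms by auto
  then have "finite {y :: 'k. poly (artin_schreier q) y = 0}"
    by (rule poly_roots_finite)
  then show ?thesis
    by (simp add: Fq_def)
qed

lemma prod_Fq:
  assumes ac: "alg_closed TYPE('k::field)" and q: "q \<ge> 2" "of_nat q = (0 :: 'k)"
  shows "(\<Prod>a\<in>Fq q. [:-a, 1:]) = (artin_schreier q :: 'k poly)"
proof -
  let ?L = "artin_schreier q :: 'k poly" and ?D = "\<Prod>a\<in>(Fq q :: 'k set). [:-a, 1:]"
  have "?D dvd ?L"
    using finite_Fq[OF q(1)] by (rule prod_linear_factors_dvd) (simp add: Fq_def)
  then obtain E where E: "?L = ?D * E"
    by (elim dvdE)
  \<comment> \<open>A root of the cofactor would be a double root of y^q - y, whose derivative is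
    -1.\<close>
  have "degree E = 0"
  proof (rule ccontr)
    assume "degree E \<noteq> 0"
    then obtain r where r: "poly E r = 0"
      using ac unfolding alg_closed_def by (metis One_nat_def Suc_leI neq0_conv)
    then have "poly ?L r = 0"
      unfolding E by simp
    then have "r \<in> Fq q"
      by (simp add: Fq_def)
    then have "poly ?D r = 0"
      using finite_Fq[OF q(1), where 'k = 'k] by (auto simp: poly_prod)
    then have "poly (pderiv ?L) r = 0"
      unfolding E using r by (simp add: pderiv_mult)
    moreover have "pderiv ?L = -1"
      using q(2) by (simp add: artin_schreier_def pderiv_diff pderiv_monom monom_0)
    ultimately show False
      by simp
  qed
  then obtain c where c: "E = [:c:]"
    by (metis degree_eq_zeroE)
  have "lead_coeff ?D = 1"
    by (simp add: lead_coeff_prod)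
  then have "c = 1"
    using lead_coeff_artin_schreier[OF q(1), where 'k = 'k] unfolding E c lead_coeff_mult by simp
  then show ?thesis
    using E c by simp
qed

lemma card_Fq:
  assumes ac: "alg_closed TYPE('k::field)" and q: "q \<ge> 2" "of_nat q = (0 :: 'k)"
  shows "card (Fq q :: 'k set) = q"
proof -
  have "degree (\<Prod>a\<in>(Fq q :: 'k set). [:-a, 1:]) = card (Fq q :: 'k set)"
    by (subst degree_prod_eq_sum_degree) auto
  then show ?thesis
    using prod_Fq[OF assms] degree_artin_schreier[OF q(1), where 'k = 'k] by simp
qed

text \<open>A counting argument in place of a primitive root: for the remainder \<open>r\<close> of
  \<open>m\<close> modulo q - 1, all q - 1 units are roots of X^r - 1, too many if 0 < r < q - 1.
  The exponent is an integer because differences of weights may be negative.\<close>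

lemma Fq_unit_exponent:
  assumes ac: "alg_closed TYPE('k::field)" and q: "q \<ge> 2" "of_nat q = (0 :: 'k)"
    and m: "\<And>b :: 'k. b \<in> Fq q \<Longrightarrow> b \<noteq> 0 \<Longrightarrow> b powi m = 1"
  shows "(int q - 1) dvd m"
proof -
  define r where "r = nat (m mod (int q - 1))"
  have r: "int r = m mod (int q - 1)" "int r < int q - 1"
    using q(1) by (simp_all add: r_def)
  have pow: "b ^ r = 1" if b: "b \<in> Fq q" "b \<noteq> 0" for b :: 'k
  proof -
    have "b * b ^ (q - 1) = b * 1"
      using b(1) q(1) by (simp add: Fq_def flip: power_Suc)
    then have "b ^ (q - 1) = 1"
      using b(2) by simp
    then have "b powi (int q - 1) = 1"
      using q(1) by (metis Suc_le_D diff_Suc_1 numeral_2_eq_2 of_nat_Suc add_diff_cancel_left' power_int_of_nat)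
    then have "1 = b powi ((int q - 1) * (m div (int q - 1)) + int r)"
      using m[OF b] by (simp add: r(1))
    also have "\<dots> = b ^ r"
      using \<open>b powi (int q - 1) = 1\<close> b(2) by (simp add: power_int_add power_int_mult)
    finally show ?thesis
      by simp
  qed
  have "r = 0"
  proof (rule ccontr)
    assume "r \<noteq> 0"
    then have deg: "degree (monom 1 r - 1 :: 'k poly) = r"
      by (subst diff_conv_add_uminus, subst degree_add_eq_left) (simp_all add: degree_monom_eq)
    then have nz: "monom 1 r - 1 \<noteq> (0 :: 'k poly)"
      using \<open>r \<noteq> 0\<close> by (metis degree_0)
    have "Fq q - {0} \<subseteq> {x :: 'k. poly (monom 1 r - 1) x = 0}"
      using pow by (auto simp: poly_monom)
    then have "card (Fq q - {0 :: 'k}) \<le> card {x :: 'k. poly (monom 1 r - 1) x = 0}"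
      using poly_roots_finite[OF nz] by (rule card_mono[rotated])
    also have "\<dots> \<le> r"
      using card_poly_roots_bound[OF nz] deg by simp
    also have "card (Fq q - {0 :: 'k}) = q - 1"
      using card_Fq[OF ac q] q(1) finite_Fq[OF q(1), where 'k = 'k] by (subst card_Diff_singleton) (auto simp: Fq_def)
    finally show False
      using r(2) by linarith
  qed
  then show ?thesis
    using r(1) by (simp add: dvd_eq_mod_eq_0)
qed

text \<open>Horner's scheme in powers of y^q - y: subtracting the value at 0 makes \<open>h\<close>
  vanish on \<open>Fq q\<close>, hence divisible by y^q - y, and the quotient inherits the
  invariance because y^q - y is itself invariant.\<close>

lemma translation_invariant_pcompose:
  fixes h :: "'k::field poly"
  assumes ac: "alg_closed TYPE('k)" and char: "CHAR('k) = p" "prime p" and q: "q = p ^ n" "n \<ge> 1"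
    and inv: "\<And>a y. a \<in> Fq q \<Longrightarrow> poly h (y + a) = poly h y"
  shows "\<exists>P. h = P \<circ>\<^sub>p artin_schreier q"
  using inv
proof (induction "degree h" arbitrary: h rule: less_induct)
  case less
  have inf: "infinite (UNIV :: 'k set)"
    using ac by (rule alg_closed_infinite)
  have "p ^ 1 \<le> p ^ n"
    using q(2) prime_gt_0_nat[OF char(2)] by (intro power_increasing) auto
  then have q2: "q \<ge> 2"
    using prime_ge_2_nat[OF char(2)] q(1) by simp
  have "p dvd q"
    using q by (simp add: dvd_power)
  then have q0: "of_nat q = (0 :: 'k)"
    using char(1) of_nat_eq_0_iff_char_dvd by blast
  let ?L = "artin_schreier q :: 'k poly"
  show ?case
  proof (cases "degree h = 0")
    case True
    then obtain c where "h = [:c:]"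
      by (metis degree_eq_zeroE)
    then have "h = [:c:] \<circ>\<^sub>p ?L"
      by simp
    then show ?thesis ..
  next
    case False
    define g where "g = h - [:poly h 0:]"
    have "poly g a = 0" if "a \<in> Fq q" for a
      using less.prems[OF that, of 0] by (simp add: g_def)
    then have "?L dvd g"
      using prod_linear_factors_dvd[OF finite_Fq[OF q2]] prod_Fq[OF ac q2 q0] by metis
    then obtain h' where h': "g = ?L * h'"
      by (elim dvdE)
    have deg_g: "degree g = degree h"
      unfolding g_def using False by (subst diff_conv_add_uminus, subst degree_add_eq_left) auto
    then have "h' \<noteq> 0"
      using False h' by auto
    moreover have "?L \<noteq> 0"
      using degree_artin_schreier[OF q2, where 'k = 'k] q2 by auto
    ultimately have "degree g = q + degree h'"
      unfolding h' by (subst degree_mult_eq) (simp_all add: degree_artin_schreier[OF q2])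
    then have "degree h' < degree h"
      using q2 deg_g by simp
    moreover have "poly h' (y + a) = poly h' y" if a: "a \<in> Fq q" for a y
    proof (rule poly_fun_eq_cofinite[OF inf _ _ finite_Fq[OF q2], of "\<lambda>y. poly h' (y + a)" "poly h'"])
      show "poly_fun (\<lambda>y. poly h' (y + a))"
        unfolding poly_fun_def by (rule exI[of _ "h' \<circ>\<^sub>p [:a, 1:]"]) (simp add: poly_pcompose add.commute)
      show "poly_fun (poly h')"
        unfolding poly_fun_def by blast
      fix y :: 'k assume y: "y \<notin> Fq q"
      have "(y + a) ^ q = y ^ q + a ^ q"
        using char q by (intro freshmans_dream') auto
      then have eq: "poly ?L (y + a) = poly ?L y"
        using a by (simp add: Fq_def)
      have "poly ?L (y + a) * poly h' (y + a) = poly ?L y * poly h' y"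
        using less.prems[OF a, of y] unfolding poly_mult[symmetric] h'[symmetric] by (simp add: g_def)
      then have "poly ?L y * poly h' (y + a) = poly ?L y * poly h' y"
        unfolding eq .
      moreover have "poly ?L y \<noteq> 0"
        using y by (simp add: Fq_def)
      ultimately show "poly h' (y + a) = poly h' y"
        using mult_left_cancel by blast
    qed
    ultimately obtain P where P: "h' = P \<circ>\<^sub>p ?L"
      using less.hyps by blast
    have "h = pCons (poly h 0) P \<circ>\<^sub>p ?L"
      using h' P by (simp add: pcompose_pCons g_def algebra_simps)
    then show ?thesis ..
  qed
qed

lemma poly_split_at_0:
  fixes P :: "'k::field poly"
  assumes "P \<noteq> 0"
  obtains m g where "P = monom 1 m * g" "poly g 0 \<noteq> 0"
proof -
  obtain g where "P = [:- 0, 1:] ^ Polynomial.order 0 P * g" "\<not> [:- 0, 1:] dvd g"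
    using order_decomp[OF assms, of 0] by blast
  then have "P = monom 1 (Polynomial.order 0 P) * g" "poly g 0 \<noteq> 0"
    by (auto simp: monom_altdef poly_eq_0_iff_dvd)
  then show ?thesis
    by (rule that)
qed

text \<open>As a binary form of degree 2e, \<open>h\<close> has order \<open>m\<close> at 0 and
  order 2e - degree h at infinity. The swap acts on the parameter of the conic by y -> 2/y and
  exchanges these two points, so the orders agree.\<close>

lemma reciprocal_degree:
  fixes h g :: "'k::field poly"
  assumes inf: "infinite (UNIV :: 'k set)" and two: "(2 :: 'k) \<noteq> 0"
    and h: "h = monom 1 m * g" and g: "poly g 0 \<noteq> 0"
    and rec: "\<And>y. y \<noteq> 0 \<Longrightarrow> (y ^ 2 / 2) powi e * poly h (2 / y) = poly h y"
  shows "int (degree h + m) = 2 * e"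
proof -
  have g0: "g \<noteq> 0"
    using g by auto
  \<comment> \<open>\<open>r\<close> is y^(degree g) g(2/y) written as a polynomial; it does not
    vanish at 0 because \<open>g\<close> has a nonzero leading coefficient.\<close>
  define r where "r = reflect_poly (g \<circ>\<^sub>p [:0, 2:])"
  have "g \<circ>\<^sub>p [:0, 2:] \<noteq> 0"
    using g0 two by (subst pcompose_eq_0_iff) auto
  then have r0: "poly r 0 \<noteq> 0"
    unfolding r_def using reflect_poly_at_0_eq_0_iff by metis
  have r: "poly r y = y ^ degree g * poly g (2 / y)" if "y \<noteq> 0" for y
    using that two by (simp add: r_def poly_reflect_poly_nz degree_pcompose poly_pcompose divide_inverse mult.commute)
  define N where "N = 2 * m + degree g"
  define C :: 'k where "C = 2 ^ m / 2 powi e"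
  have C: "C \<noteq> 0"
    using two by (simp add: C_def)
  have eq: "y powi (2 * e) * C * poly r y = y powi (int N) * poly g y" if y: "y \<noteq> 0" for y
  proof -
    have "y powi (2 * e) * C * poly r y = (y ^ 2 / 2) powi e * (2 ^ m * poly r y)"
      by (simp add: C_def power_int_divide_distrib power_int_mult)
    also have "2 ^ m * poly r y = poly h (2 / y) * y ^ m * y ^ degree g"
    proof -
      have "(2 / y) ^ m * y ^ m = 2 ^ m"
        using y by (simp add: power_divide)
      then have "2 ^ m * poly r y = ((2 / y) ^ m * y ^ m) * (y ^ degree g * poly g (2 / y))"
        using r[OF y] by simp
      then show ?thesis
        by (simp only: h poly_mult poly_monom mult_1 mult_ac)
    qed
    also have "(y ^ 2 / 2) powi e * \<dots> = ((y ^ 2 / 2) powi e * poly h (2 / y)) * y ^ m * y ^ degree g"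
      by (simp only: mult_ac)
    also have "\<dots> = y ^ N * poly g y"
      unfolding rec[OF y] by (simp add: h poly_monom N_def power_add mult_2)
    finally show ?thesis
      by simp
  qed
  \<comment> \<open>Neither \<open>r\<close> nor \<open>g\<close> vanishes at 0, so the powers of y
    on the two sides must agree. An excess on either side would make one of them vanish at 0 after
    cancellation; the case split is needed since \<open>e\<close> may be negative.\<close>
  have "2 * e = int N"
  proof (rule linorder_cases[of "2 * e" "int N"])
    assume less: "2 * e < int N"
    define k where "k = nat (int N - 2 * e)"
    have k: "k > 0" "int N = 2 * e + int k"
      using less by (simp_all add: k_def)
    have *: "C * poly r y = y ^ k * poly g y" if "y \<noteq> 0" for y
      using eq[OF that] that by (simp add: k(2) power_int_add)
    have "C * poly r 0 = 0 ^ k * poly g 0"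
      by (rule poly_fun_eq_cofinite[OF inf, of "\<lambda>y. C * poly r y" "\<lambda>y. y ^ k * poly g y" "{0}"])
        (auto simp: * intro!: poly_fun_intros)
    then show ?thesis
      using C r0 k(1) by (simp add: zero_power)
  next
    assume less: "2 * e > int N"
    define k where "k = nat (2 * e - int N)"
    have k: "k > 0" "2 * e = int N + int k"
      using less by (simp_all add: k_def)
    have *: "y ^ k * (C * poly r y) = poly g y" if "y \<noteq> 0" for y
      using eq[OF that] that by (simp add: k(2) power_int_add)
    have "0 ^ k * (C * poly r 0) = poly g 0"
      by (rule poly_fun_eq_cofinite[OF inf, of "\<lambda>y. y ^ k * (C * poly r y)" "poly g" "{0}"])
        (auto simp: * intro!: poly_fun_intros)
    then show ?thesis
      using g k(1) by (simp add: zero_power)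
  qed
  moreover have "degree h = m + degree g"
    unfolding h using g0 by (subst degree_mult_eq) (simp_all add: degree_monom_eq)
  ultimately show ?thesis
    by (simp add: N_def)
qed

text \<open>Writing h as P(y^q - y), the scalings confine the exponents of P to one class modulo q - 1, and
the reciprocity gives q deg P + ord P = 2e, which leaves deg P - ord P in {0, q - 1}; parity excludes
the second value.\<close>

lemma binary_invariant:
  fixes h :: "'k::field poly"
  assumes ac: "alg_closed TYPE('k)" and char: "CHAR('k) = p" "prime p" "odd p"
    and q: "q = p ^ n" "n \<ge> 1" and e: "even e" "e < int (q ^ 2 - q)"
    and trans: "\<And>a y. a \<in> Fq q \<Longrightarrow> poly h (y + a) = poly h y"
    and scale: "\<And>b y. b \<in> Fq q \<Longrightarrow> b \<noteq> 0 \<Longrightarrow> poly h (b * y) = b powi e * poly h y"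
    and rec: "\<And>y. y \<noteq> 0 \<Longrightarrow> (y ^ 2 / 2) powi e * poly h (2 / y) = poly h y"
  shows "h = 0 \<or> (\<exists>c i. e = int ((q + 1) * i) \<and> (\<forall>y. poly h y = c * (y ^ q - y) ^ (2 * i)))"
proof (cases "h = 0")
  case False
  have inf: "infinite (UNIV :: 'k set)"
    using ac by (rule alg_closed_infinite)
  have "p ^ 1 \<le> p ^ n"
    using q(2) prime_gt_0_nat[OF char(2)] by (intro power_increasing) auto
  then have q2: "q \<ge> 2"
    using prime_ge_2_nat[OF char(2)] q(1) by simp
  have "p dvd q"
    using q by (simp add: dvd_power)
  then have q0: "of_nat q = (0 :: 'k)"
    using char(1) of_nat_eq_0_iff_char_dvd by blast
  have odd: "odd q"
    using char q by simp
  let ?L = "artin_schreier q :: 'k poly"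
  obtain P where P: "h = P \<circ>\<^sub>p ?L"
    using translation_invariant_pcompose[OF ac char(1,2) q trans] by blast
  then have "P \<noteq> 0"
    using False by auto
  then obtain m g where m: "P = monom 1 m * g" and g: "poly g 0 \<noteq> 0"
    by (rule poly_split_at_0)
  have g0: "g \<noteq> 0"
    using g by auto
  have deg_P: "degree P = m + degree g"
    unfolding m using g0 by (subst degree_mult_eq) (simp_all add: degree_monom_eq)
  \<comment> \<open>Every element \<open>w\<close> is a value y^q - y, and this value is multiplied
    by b when y is, for b in \<open>Fq q\<close>. So P(b w) is b^e P(w), and comparing the
    coefficients of w^j gives b^j = b^e.\<close>
  have cong: "(int q - 1) dvd (int j - e)" if j: "coeff P j \<noteq> 0" for j
  proof (rule Fq_unit_exponent[OF ac q2 q0])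
    fix b :: 'k assume b: "b \<in> Fq q" "b \<noteq> 0"
    have "poly (P \<circ>\<^sub>p [:0, b:]) w = poly (smult (b powi e) P) w" for w
    proof -
      have "degree (?L - [:w:]) = q"
        using q2 degree_artin_schreier[OF q2, where 'k = 'k]
        by (subst diff_conv_add_uminus, subst degree_add_eq_left) auto
      then have "degree (?L - [:w:]) \<ge> 1"
        using q2 by simp
      then obtain y where "poly (?L - [:w:]) y = 0"
        using ac unfolding alg_closed_def by blast
      then have y: "w = y ^ q - y"
        by simp
      have "b * w = (b * y) ^ q - b * y"
        using b(1) unfolding y power_mult_distrib by (simp add: Fq_def algebra_simps)
      then have "poly P (b * w) = poly h (b * y)"
        by (simp add: P poly_pcompose)
      also have "\<dots> = b powi e * poly P w"
        unfolding scale[OF b] by (simp add: P poly_pcompose y)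
      finally show ?thesis
        by (simp add: poly_pcompose mult.commute)
    qed
    then have "P \<circ>\<^sub>p [:0, b:] - smult (b powi e) P = 0"
      by (intro poly_eq_0_cofinite[OF inf, of "{}"]) auto
    then have "coeff (P \<circ>\<^sub>p [:0, b:]) j = coeff (smult (b powi e) P) j"
      by simp
    then have "b ^ j = b powi e"
      using j by (simp add: coeff_pcompose_linear)
    then show "b powi (int j - e) = 1"
      using b(2) by (simp add: power_int_diff)
  qed
  have "coeff P m = poly g 0"
    by (simp add: m coeff_monom_mult poly_0_coeff_0)
  then have cm: "(int q - 1) dvd (int m - e)"
    using g cong by simp
  have "(int q - 1) dvd (int (degree P) - e)"
    using \<open>P \<noteq> 0\<close> cong by simp
  then have "(int q - 1) dvd (int (degree P) - e) - (int m - e)"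
    using cm by (rule dvd_diff)
  then have "(int q - 1) dvd int (degree g)"
    by (simp add: deg_P)
  then obtain k where k: "int (degree g) = (int q - 1) * k"
    by (elim dvdE)
  \<comment> \<open>Since y^q - y is y times a factor that is nonzero at 0, the order of
    \<open>h\<close> at 0 equals the order \<open>m\<close> of \<open>P\<close>.\<close>
  have "int (degree h + m) = 2 * e"
  proof (rule reciprocal_degree[OF inf CHAR_odd_two_neq_0[OF char] _ _ rec])
    have L: "?L = monom 1 1 * (monom 1 (q - 1) - 1)"
      using q2 by (simp add: artin_schreier_def algebra_simps mult_monom)
    have "monom 1 m \<circ>\<^sub>p ?L = ?L ^ m"
      by (simp add: monom_altdef pcompose_hom.hom_power)
    also have "\<dots> = monom 1 m * (monom 1 (q - 1) - 1) ^ m"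
      by (simp add: L power_mult_distrib monom_power)
    finally show "h = monom 1 m * ((monom 1 (q - 1) - 1) ^ m * (g \<circ>\<^sub>p ?L))"
      unfolding P m pcompose_mult by (simp only: mult.assoc)
    show "poly ((monom 1 (q - 1) - 1) ^ m * (g \<circ>\<^sub>p ?L)) 0 \<noteq> 0"
      using g q2 by (simp add: poly_pcompose poly_monom power_0_left)
  qed
  moreover have "degree h = q * degree P"
    unfolding P by (simp add: degree_pcompose degree_artin_schreier[OF q2])
  ultimately have e2: "2 * e = (int q + 1) * int m + int q * (int q - 1) * k"
    by (simp add: deg_P k algebra_simps)
  have q_diff: "int (q ^ 2 - q) = int q * (int q - 1)"
    by (simp add: power2_eq_square of_nat_diff algebra_simps)
  have "int q * (int q - 1) * k \<le> 2 * e"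
    unfolding e2 by simp
  also have "\<dots> < int q * (int q - 1) * 2"
    using e(2) unfolding q_diff by simp
  finally have "k < 2"
    using q2 by (simp add: mult_less_cancel_left)
  moreover have "0 \<le> (int q - 1) * k"
    unfolding k[symmetric] by simp
  then have "k \<ge> 0"
    using q2 by (simp add: zero_le_mult_iff)
  ultimately consider "k = 0" | "k = 1"
    by linarith
  then show ?thesis
  proof cases
    case 1
    have "even (int q - 1)"
      using odd by simp
    then have "even (int m - e)"
      using cm by (rule dvd_trans)
    then have "even m"
      using e(1) by simp
    then obtain i where i: "m = 2 * i"
      by (elim evenE)
    have "degree g = 0"
      using k 1 by simp
    then obtain c where c: "g = [:c:]"
      by (metis degree_eq_zeroE)
    have "poly h y = c * (y ^ q - y) ^ (2 * i)" for y
      by (simp add: P poly_pcompose m c i poly_monom)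
    moreover have "e = int ((q + 1) * i)"
      using e2 1 i by (simp add: algebra_simps)
    ultimately show ?thesis
      by blast
  next
    case 2
    obtain s where s: "int m - e = (int q - 1) * s"
      using cm by (elim dvdE)
    \<comment> \<open>For k = 1 the degree relation, divided by q - 1, makes m + q even, so
      \<open>m\<close> is odd. The congruence of \<open>m\<close> and \<open>e\<close> modulo the
      even number q - 1 makes \<open>m\<close> even.\<close>
    have "(int q - 1) * (int m + int q) = 2 * (e - int m)"
      using e2 2 by (simp add: algebra_simps)
    also have "\<dots> = (int q - 1) * (2 * (- s))"
      using s by (simp add: algebra_simps)
    finally have "int m + int q = 2 * (- s)"
      using q2 by (subst (asm) mult_cancel_left) auto
    then have "odd m"
      using odd by presburger
    moreover have "even (int q - 1)"
      using odd by simp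
    then have "even (int m - e)"
      using cm by (rule dvd_trans)
    then have "even m"
      using e(1) by simp
    ultimately show ?thesis
      by simp
  qed
qed simp

section \<open>Expansion along the conic\<close>

text \<open>A polynomial H in (t, y) stands for the function H(y^2 - 2x, y) on the chart Z = 1: t is the conic
and is invariant under the translations, which become y -> y + a. The identities are required only off
the conic so that they survive division by t; they extend to t = 0 by Zariski density. The weight e is
an integer because that division lowers it by 2.\<close>

definition affine_invariant :: "nat \<Rightarrow> int \<Rightarrow> 'k::field poly poly \<Rightarrow> bool" where
  "affine_invariant q e H \<longleftrightarrow>
    (\<forall>a\<in>Fq q. \<forall>t y. t \<noteq> 0 \<longrightarrow> eval2 H t (y + a) = eval2 H t y) \<and>
    (\<forall>b\<in>Fq q. b \<noteq> 0 \<longrightarrow> (\<forall>t y. t \<noteq> 0 \<longrightarrow> eval2 H (b ^ 2 * t) (b * y) = b powi e * eval2 H t y)) \<and>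
    (\<forall>x y. x \<noteq> 0 \<longrightarrow> y ^ 2 \<noteq> 2 * x \<longrightarrow>
      x powi e * eval2 H ((y ^ 2 - 2 * x) / x ^ 2) (y / x) = eval2 H (y ^ 2 - 2 * x) y)"

lemma affine_invariant_pCons_0:
  assumes "affine_invariant q e (pCons 0 H)"
  shows "affine_invariant q (e - 2) H"
  using assms unfolding affine_invariant_def
  by (auto simp: power_int_diff divide_simps mult_ac)

lemma affine_invariant_diff:
  assumes "affine_invariant q e G" "affine_invariant q e H"
  shows "affine_invariant q e (G - H)"
  using assms unfolding affine_invariant_def by (auto simp: algebra_simps)

lemma affine_invariant_cmult:
  assumes "affine_invariant q e H"
  shows "affine_invariant q e ([:[:c:]:] * H)"
  using assms unfolding affine_invariant_def by (auto simp: algebra_simps)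

lemma affine_invariant_power:
  assumes "affine_invariant q e H"
  shows "affine_invariant q (e * int i) (H ^ i)"
proof -
  have pow: "x powi (e * int i) = (x powi e) ^ i" for x :: 'a
    by (simp add: power_int_mult)
  show ?thesis
    using assms unfolding affine_invariant_def by (simp add: pow flip: power_mult_distrib)
qed

lemma affine_invariant_on_conic:
  fixes H :: "'k::field poly poly"
  assumes inf: "infinite (UNIV :: 'k set)" and two: "(2 :: 'k) \<noteq> 0"
    and inv: "affine_invariant q e H"
  shows "\<And>a y. a \<in> Fq q \<Longrightarrow> eval2 H 0 (y + a) = eval2 H 0 y"
    and "\<And>b y. b \<in> Fq q \<Longrightarrow> b \<noteq> 0 \<Longrightarrow> eval2 H 0 (b * y) = b powi e * eval2 H 0 y"
    and "\<And>y. y \<noteq> 0 \<Longrightarrow> (y ^ 2 / 2) powi e * eval2 H 0 (2 / y) = eval2 H 0 y"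
proof -
  show "eval2 H 0 (y + a) = eval2 H 0 y" if "a \<in> Fq q" for a y
    by (rule poly_fun_eq_cofinite[OF inf, of "\<lambda>t. eval2 H t (y + a)" "\<lambda>t. eval2 H t y" "{0}"])
      (use inv that in \<open>auto simp: affine_invariant_def intro!: poly_fun_intros\<close>)
  show "eval2 H 0 (b * y) = b powi e * eval2 H 0 y" if "b \<in> Fq q" "b \<noteq> 0" for b y
  proof -
    have "eval2 H (b ^ 2 * 0) (b * y) = b powi e * eval2 H 0 y"
      by (rule poly_fun_eq_cofinite[OF inf, of "\<lambda>t. eval2 H (b ^ 2 * t) (b * y)" "\<lambda>t. b powi e * eval2 H t y" "{0}"])
        (use inv that in \<open>auto simp: affine_invariant_def intro!: poly_fun_intros\<close>)
    then show ?thesis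
      by simp
  qed
  show "(y0 ^ 2 / 2) powi e * eval2 H 0 (2 / y0) = eval2 H 0 y0" if "y0 \<noteq> 0" for y0
  proof -
    \<comment> \<open>\<open>x\<close> is frozen at its value on the conic and only y varies. This
      line meets the conic just in \<open>y0\<close> and \<open>- y0\<close>, so the identity known
      elsewhere on it extends to \<open>y0\<close>.\<close>
    define x where "x = y0 ^ 2 / 2"
    have x: "x \<noteq> 0" "y0 ^ 2 = 2 * x"
      using that two by (simp_all add: x_def)
    have "x powi e * eval2 H ((y0 ^ 2 - 2 * x) * inverse (x ^ 2)) (y0 * inverse x) = eval2 H (y0 ^ 2 - 2 * x) y0"
    proof (rule poly_fun_eq_cofinite[OF inf,
          of "\<lambda>y. x powi e * eval2 H ((y ^ 2 - 2 * x) * inverse (x ^ 2)) (y * inverse x)"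
             "\<lambda>y. eval2 H (y ^ 2 - 2 * x) y" "{y0, - y0}"])
      fix y assume "y \<notin> {y0, - y0}"
      then have "y ^ 2 \<noteq> 2 * x"
        unfolding x(2)[symmetric] by (simp add: power2_eq_iff)
      then show "x powi e * eval2 H ((y ^ 2 - 2 * x) * inverse (x ^ 2)) (y * inverse x) = eval2 H (y ^ 2 - 2 * x) y"
        using inv x(1) by (simp add: affine_invariant_def divide_inverse)
    qed (auto intro!: poly_fun_intros)
    moreover have "y0 * inverse x = 2 / y0"
      using that two by (simp add: x_def field_simps power2_eq_square)
    ultimately have "x powi e * eval2 H 0 (2 / y0) = eval2 H 0 y0"
      using x(2) by simp
    then show ?thesis
      unfolding x_def .
  qed
qed

text \<open>An isobaric combination of the U^i t^j, where \<open>U\<close> has weight q + 1 and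
  \<open>t\<close> has weight 2. The support condition makes the truncated subtraction exact on the
  terms that occur, and for even \<open>e\<close> and odd \<open>q\<close> so is the
  halving.\<close>

definition conic_expansion :: "nat \<Rightarrow> 'k::field poly poly \<Rightarrow> nat \<Rightarrow> 'k poly poly \<Rightarrow> bool" where
  "conic_expansion q U e H \<longleftrightarrow> (\<exists>c. (\<forall>i. c i \<noteq> 0 \<longrightarrow> (q + 1) * i \<le> e) \<and>
    (\<forall>t y. eval2 H t y = (\<Sum>i\<le>e. c i * eval2 U t y ^ i * t ^ ((e - (q + 1) * i) div 2))))"

lemma conic_expansion_0: "conic_expansion q U e 0"
  unfolding conic_expansion_def by (intro exI[of _ "\<lambda>_. 0"]) simp

lemma conic_expansion_shift:
  assumes "conic_expansion q U e H"
  shows "conic_expansion q U (e + 2) (pCons 0 H)"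
proof -
  obtain c where c: "\<And>i. c i \<noteq> 0 \<Longrightarrow> (q + 1) * i \<le> e"
    and H: "\<And>t y. eval2 H t y = (\<Sum>i\<le>e. c i * eval2 U t y ^ i * t ^ ((e - (q + 1) * i) div 2))"
    using assms unfolding conic_expansion_def by blast
  have "eval2 (pCons 0 H) t y =
      (\<Sum>i\<le>e + 2. c i * eval2 U t y ^ i * t ^ ((e + 2 - (q + 1) * i) div 2))" for t y
  proof -
    have shift: "t * (c i * eval2 U t y ^ i * t ^ ((e - (q + 1) * i) div 2)) =
        c i * eval2 U t y ^ i * t ^ ((e + 2 - (q + 1) * i) div 2)" for i
    proof (cases "c i = 0")
      case False
      then have "e + 2 - (q + 1) * i = (e - (q + 1) * i) + 2"
        using c[of i] by linarith
      then have "(e + 2 - (q + 1) * i) div 2 = Suc ((e - (q + 1) * i) div 2)"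
        by presburger
      then show ?thesis
        by (simp only: power_Suc mult_ac)
    qed simp
    have "eval2 (pCons 0 H) t y = (\<Sum>i\<le>e. c i * eval2 U t y ^ i * t ^ ((e + 2 - (q + 1) * i) div 2))"
      by (simp only: eval2_simps poly_0 add_0 H sum_distrib_left shift)
    also have "\<dots> = (\<Sum>i\<le>e + 2. c i * eval2 U t y ^ i * t ^ ((e + 2 - (q + 1) * i) div 2))"
    proof (rule sum.mono_neutral_left)
      have "c i = 0" if "i > e" for i
        using c[of i] that by fastforce
      then show "\<forall>i\<in>{..e + 2} - {..e}. c i * eval2 U t y ^ i * t ^ ((e + 2 - (q + 1) * i) div 2) = 0"
        by auto
    qed auto
    finally show ?thesis .
  qed
  moreover have "(q + 1) * i \<le> e + 2" if "c i \<noteq> 0" for i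
    using c[OF that] by simp
  ultimately show ?thesis
    unfolding conic_expansion_def by blast
qed

lemma conic_expansion_add_power:
  assumes "conic_expansion q U e H" and i: "(q + 1) * i = e"
  shows "conic_expansion q U e (H + [:[:k:]:] * U ^ i)"
proof -
  obtain c where c: "\<And>i. c i \<noteq> 0 \<Longrightarrow> (q + 1) * i \<le> e"
    and H: "\<And>t y. eval2 H t y = (\<Sum>i\<le>e. c i * eval2 U t y ^ i * t ^ ((e - (q + 1) * i) div 2))"
    using assms unfolding conic_expansion_def by blast
  let ?c = "\<lambda>j. c j + (if j = i then k else 0)"
  have "i \<le> e"
    using i by auto
  then have "eval2 (H + [:[:k:]:] * U ^ i) t y =
      (\<Sum>j\<le>e. ?c j * eval2 U t y ^ j * t ^ ((e - (q + 1) * j) div 2))" for t y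
    using i by (simp add: H distrib_right sum.distrib if_distrib[of "\<lambda>x. x * _"] sum.delta cong: if_cong)
  moreover have "(q + 1) * j \<le> e" if "?c j \<noteq> 0" for j
    using that c[of j] i by (auto split: if_splits)
  ultimately show ?thesis
    unfolding conic_expansion_def by (intro exI[of _ ?c]) blast
qed

lemma two_power_q:
  assumes char: "CHAR('k::field) = p" "prime p" and q: "q = p ^ n"
  shows "(2 :: 'k) ^ q = 2"
proof -
  have "((1 :: 'k) + 1) ^ q = 1 ^ q + 1 ^ q"
    using char q by (intro freshmans_dream') auto
  then show ?thesis
    by simp
qed

text \<open>The q-th power map is additive and fixes 2, \<open>a\<close> and \<open>b\<close>. On
  the conic x = y^2/2, the form becomes y^(q+1) - (y^(2q) + y^2)/2, which is minus half a
  square.\<close>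

lemma affine_invariant_hermitian:
  fixes U :: "'k::field poly poly"
  assumes char: "CHAR('k) = p" "prime p" "odd p" and q: "q = p ^ n"
    and U: "\<And>t y. eval2 U t y = eval3 (hermitian3 q) (1 / 2 * (y ^ 2 - t), y, 1)"
  shows "affine_invariant q (int (q + 1)) U"
    and "eval2 U 0 y = - ((y ^ q - y) ^ 2 / 2)"
proof -
  have two: "(2 :: 'k) \<noteq> 0"
    using CHAR_odd_two_neq_0[OF char] .
  have "(4 :: 'k) = 2 * 2"
    by simp
  then have four: "(4 :: 'k) \<noteq> 0"
    using two by (metis mult_eq_0_iff)
  have two_q: "(2 :: 'k) ^ q = 2"
    by (rule two_power_q[OF char(1,2) q])
  have dream: "(u + v) ^ q = u ^ q + v ^ q" for u v :: 'k
    using char q by (intro freshmans_dream') auto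
  have comm: "(u ^ 2) ^ q = (u ^ q) ^ 2" for u :: 'k
    by (simp add: mult.commute flip: power_mult)
  show "eval2 U 0 y = - ((y ^ q - y) ^ 2 / 2)"
    using two by (simp add: U power_divide two_q comm power2_diff field_simps)
  have trans: "eval2 U t (y + a) = eval2 U t y" if a: "a \<in> Fq q" for a t y
  proof -
    define x where "x = 1 / 2 * (y ^ 2 - t)"
    \<comment> \<open>Naming a^2/2, itself an element of \<open>Fq q\<close>, keeps the expansion
      free of fractions: \<open>a * a = h + h\<close> and \<open>h ^ q = h\<close> suffice.\<close>
    define h where "h = a ^ 2 / 2"
    have h: "a * a = h + h"
      using two by (simp add: h_def power2_eq_square flip: mult_2)
    have aq: "a ^ q = a"
      using a by (simp add: Fq_def)
    have hq: "h ^ q = h"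
      by (simp add: h_def power_divide two_q comm aq)
    have x': "1 / 2 * ((y + a) ^ 2 - t) = x + (a * y + h)"
      using two four by (simp add: x_def h_def field_simps power2_eq_square)
    have "eval2 U t (y + a) = (y + a) ^ (q + 1) - ((x + (a * y + h)) ^ q + (x + (a * y + h)))"
      by (simp only: U x' eval3_hermitian3 power_one mult_1_right)
    also have "\<dots> = (y ^ q + a) * (y + a) - (x ^ q + (a * y ^ q + h) + (x + (a * y + h)))"
      by (simp only: dream power_mult_distrib aq hq power_add power_one_right)
    also have "\<dots> = y ^ (q + 1) - (x ^ q + x)"
      by (simp add: algebra_simps h)
    also have "\<dots> = eval2 U t y"
      by (simp only: U x_def eval3_hermitian3 power_one mult_1_right)
    finally show ?thesis .
  qed
  have scale: "eval2 U (b ^ 2 * t) (b * y) = b ^ (q + 1) * eval2 U t y" if b: "b \<in> Fq q" for b t y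
  proof -
    define x where "x = 1 / 2 * (y ^ 2 - t)"
    have bq: "b ^ q = b"
      using b by (simp add: Fq_def)
    have x': "1 / 2 * ((b * y) ^ 2 - b ^ 2 * t) = b ^ 2 * x"
      by (simp add: x_def power_mult_distrib right_diff_distrib)
    have "eval2 U (b ^ 2 * t) (b * y) = (b * y) ^ (q + 1) - ((b ^ 2 * x) ^ q + b ^ 2 * x)"
      by (simp only: U x' eval3_hermitian3 power_one mult_1_right)
    also have "\<dots> = b ^ (q + 1) * (y ^ (q + 1) - (x ^ q + x))"
      by (simp add: power_mult_distrib comm bq power2_eq_square algebra_simps)
    also have "\<dots> = b ^ (q + 1) * eval2 U t y"
      by (simp only: U x_def eval3_hermitian3 power_one mult_1_right)
    finally show ?thesis .
  qed
  have rec: "x ^ (q + 1) * eval2 U ((y ^ 2 - 2 * x) / x ^ 2) (y / x) = eval2 U (y ^ 2 - 2 * x) y"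
    if x: "x \<noteq> 0" for x y
  proof -
    have "(y / x) ^ 2 - (y ^ 2 - 2 * x) / x ^ 2 = 2 * x / x ^ 2"
      by (simp add: power_divide diff_divide_distrib)
    then have x': "1 / 2 * ((y / x) ^ 2 - (y ^ 2 - 2 * x) / x ^ 2) = 1 / x"
      using x two by (simp add: power2_eq_square)
    have "x ^ (q + 1) * eval2 U ((y ^ 2 - 2 * x) / x ^ 2) (y / x) =
        x ^ (q + 1) * ((y / x) ^ (q + 1) - ((1 / x) ^ q + 1 / x))"
      by (simp only: U x' eval3_hermitian3 power_one mult_1_right)
    also have "\<dots> = y ^ (q + 1) - (x ^ q + x)"
      using x by (simp add: power_divide right_diff_distrib distrib_left)
    also have "\<dots> = eval2 U (y ^ 2 - 2 * x) y"
      using two by (simp add: U)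
    finally show ?thesis .
  qed
  show "affine_invariant q (int (q + 1)) U"
    unfolding affine_invariant_def power_int_of_nat using trans scale rec by blast
qed

text \<open>A nonzero restriction to the conic has weight (q + 1) i, which is never negative. So
  each coefficient in \<open>t\<close> vanishes in turn while the weight drops further. This is the
  bottom of the descent on the weight.\<close>

lemma affine_invariant_negative:
  fixes H :: "'k::field poly poly"
  assumes ac: "alg_closed TYPE('k)" and char: "CHAR('k) = p" "prime p" "odd p"
    and q: "q = p ^ n" "n \<ge> 1" and e: "even e" "e < 0"
    and inv: "affine_invariant q e H"
  shows "H = 0"
  using e inv
proof (induction H arbitrary: e)
  case (pCons a H)
  note conic = affine_invariant_on_conic[OF alg_closed_infinite[OF ac] CHAR_odd_two_neq_0[OF char] pCons.prems(3)]
  have "e < int (q ^ 2 - q)"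
    using pCons.prems(2) by linarith
  then have "a = 0 \<or> (\<exists>c i. e = int ((q + 1) * i) \<and> (\<forall>y. poly a y = c * (y ^ q - y) ^ (2 * i)))"
    using conic by (intro binary_invariant[OF ac char q pCons.prems(1)]) simp_all
  moreover have "e \<noteq> int ((q + 1) * i)" for i
    using pCons.prems(2) of_nat_0_le_iff[of "(q + 1) * i", where 'a = int] by linarith
  ultimately have "a = 0"
    by blast
  moreover have "H = 0"
    using pCons.prems \<open>a = 0\<close> by (intro pCons.IH[of "e - 2"]) (simp_all add: affine_invariant_pCons_0)
  ultimately show ?case
    by simp
qed simp

lemma affine_invariant_expansion:
  fixes H U :: "'k::field poly poly"
  assumes ac: "alg_closed TYPE('k)" and char: "CHAR('k) = p" "prime p" "odd p"
    and q: "q = p ^ n" "n \<ge> 1"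
    and U: "\<And>t y. eval2 U t y = eval3 (hermitian3 q) (1 / 2 * (y ^ 2 - t), y, 1)"
    and e: "even e" "e < q ^ 2 - q" and inv: "affine_invariant q (int e) H"
  shows "conic_expansion q U e H"
  using e inv
proof (induction e arbitrary: H rule: less_induct)
  case (less e)
  have inf: "infinite (UNIV :: 'k set)"
    using ac by (rule alg_closed_infinite)
  have two: "(2 :: 'k) \<noteq> 0"
    using CHAR_odd_two_neq_0[OF char] .
  have vanishing: "conic_expansion q U e G"
    if G: "affine_invariant q (int e) G" "\<And>y. eval2 G 0 y = 0" for G
  proof -
    obtain a G1 where G1: "G = pCons a G1"
      by (rule pCons_cases)
    have "a = 0"
      using G(2) by (intro poly_eq_0_cofinite[OF inf, of "{}"]) (auto simp: G1)
    then have inv1: "affine_invariant q (int e - 2) G1"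
      using G(1) by (intro affine_invariant_pCons_0) (simp add: G1)
    \<comment> \<open>For weight 0 the quotient by the conic has weight -2 and vanishes; otherwise
      the induction hypothesis applies to it.\<close>
    show ?thesis
    proof (cases "e < 2")
      case True
      then have "G1 = 0"
        using less.prems by (intro affine_invariant_negative[OF ac char q _ _ inv1]) auto
      then show ?thesis
        by (simp add: G1 \<open>a = 0\<close> conic_expansion_0)
    next
      case False
      then have "conic_expansion q U (e - 2) G1"
        using inv1 less.prems by (intro less.IH) (auto simp: of_nat_diff)
      then show ?thesis
        using conic_expansion_shift[of q U "e - 2" G1] False
        by (simp only: G1 \<open>a = 0\<close> le_add_diff_inverse2 not_less)
    qed
  qed
  obtain a H1 where H1: "H = pCons a H1"
    by (rule pCons_cases)
  note conic = affine_invariant_on_conic[OF inf two less.prems(3)]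
  have bound: "int e < int (q ^ 2 - q)"
    using less.prems(2) by (rule iffD2[OF of_nat_less_iff])
  have "a = 0 \<or> (\<exists>c i. int e = int ((q + 1) * i) \<and> (\<forall>y. poly a y = c * (y ^ q - y) ^ (2 * i)))"
    by (rule binary_invariant[OF ac char q _ bound]) (use conic less.prems(1) in \<open>simp_all add: H1\<close>)
  then consider "a = 0"
    | c i where "e = (q + 1) * i" "\<And>y. poly a y = c * (y ^ q - y) ^ (2 * i)"
    by (metis of_nat_eq_iff)
  then show ?case
  proof cases
    case 1
    then show ?thesis
      using less.prems(3) by (intro vanishing) (simp_all add: H1)
  next
    case (2 c i)
    \<comment> \<open>The Hermitian form restricts to -(y^q - y)^2/2, and the factor (-2)^i
      compensates for this.\<close>
    let ?T = "[:[:c * (- 2) ^ i:]:] * U ^ i"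
    have "affine_invariant q (int e) (U ^ i)"
      using affine_invariant_power[OF affine_invariant_hermitian(1)[OF char q(1) U], of i]
      by (simp only: 2(1) of_nat_mult)
    then have inv: "affine_invariant q (int e) (H - ?T)"
      by (intro affine_invariant_diff affine_invariant_cmult less.prems(3))
    have "eval2 ?T 0 y = poly a y" for y
    proof -
      have "eval2 ?T 0 y = c * ((- 2) * (- ((y ^ q - y) ^ 2 / 2))) ^ i"
        by (simp only: eval2_simps poly_pCons poly_0 affine_invariant_hermitian(2)[OF char q(1) U]
            power_mult_distrib mult_zero_left mult_zero_right add_0_right mult.assoc)
      also have "(- 2) * (- ((y ^ q - y) ^ 2 / 2)) = (y ^ q - y) ^ 2"
        using two by simp
      finally show ?thesis
        by (simp add: 2(2) power_mult)
    qed
    then have "conic_expansion q U e (H - ?T)"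
      using inv by (intro vanishing) (simp_all add: H1)
    then show ?thesis
      using conic_expansion_add_power[of q U e "H - ?T" i "c * (- 2) ^ i"] 2(1) by simp
  qed
qed

section \<open>Invariant curves\<close>

text \<open>A binary form in A and B that vanishes at (r : 1) is divisible by A - rB: subtract its
  zero value at A = rB and use that each difference of i-th powers has this factor.\<close>

lemma homogeneous_root_dvd:
  fixes A B :: "'k::field poly3"
  assumes inf: "infinite (UNIV :: 'k set)" and root: "(\<Sum>i\<le>M. c i * r ^ i) = 0"
  shows "A - const3 r * B dvd (\<Sum>i\<le>M. const3 (c i) * A ^ i * B ^ (M - i))"
proof -
  let ?C = "const3 r * B"
  have "(\<Sum>i\<le>M. const3 (c i) * ?C ^ i * B ^ (M - i)) = 0"
  proof (rule eval3_eq_0[OF inf])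
    fix v
    have *: "c i * (r * eval3 B v) ^ i * eval3 B v ^ (M - i) = c i * r ^ i * eval3 B v ^ M" if "i \<le> M" for i
    proof -
      have "eval3 B v ^ M = eval3 B v ^ i * eval3 B v ^ (M - i)"
        using that by (simp flip: power_add)
      then show ?thesis
        by (simp add: power_mult_distrib mult.assoc)
    qed
    have "eval3 (\<Sum>i\<le>M. const3 (c i) * ?C ^ i * B ^ (M - i)) v =
        (\<Sum>i\<le>M. c i * (r * eval3 B v) ^ i * eval3 B v ^ (M - i))"
      by simp
    also have "\<dots> = (\<Sum>i\<le>M. c i * r ^ i * eval3 B v ^ M)"
      by (intro sum.cong refl *) simp
    also have "\<dots> = (\<Sum>i\<le>M. c i * r ^ i) * eval3 B v ^ M"
      by (simp only: sum_distrib_right)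
    finally show "eval3 (\<Sum>i\<le>M. const3 (c i) * ?C ^ i * B ^ (M - i)) v = 0"
      using root by simp
  qed
  then have "(\<Sum>i\<le>M. const3 (c i) * A ^ i * B ^ (M - i)) =
      (\<Sum>i\<le>M. const3 (c i) * A ^ i * B ^ (M - i)) - (\<Sum>i\<le>M. const3 (c i) * ?C ^ i * B ^ (M - i))"
    by simp
  also have "\<dots> = (\<Sum>i\<le>M. (A ^ i - ?C ^ i) * (const3 (c i) * B ^ (M - i)))"
    unfolding sum_subtractf[symmetric] by (simp add: algebra_simps)
  also have "A - ?C dvd \<dots>"
  proof (rule dvd_sum)
    fix i
    have "A - ?C dvd A ^ i - ?C ^ i"
      unfolding power_diff_sumr2 by (rule dvd_triv_left)
    then show "A - ?C dvd (A ^ i - ?C ^ i) * (const3 (c i) * B ^ (M - i))"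
      by (rule dvd_mult2)
  qed
  finally show ?thesis .
qed

lemma invariant_curve_expansion:
  fixes F :: "'k::field poly3"
  assumes ac: "alg_closed TYPE('k)" and char: "CHAR('k) = p" "prime p" "odd p"
    and q: "q = p ^ n" "n \<ge> 1" and irr: "irreducible F" and hom: "homogeneous3 F d"
    and inv: "invariant_curve q F" and d: "d > 1" "d < q ^ 2 - q"
  shows "even d \<and> (\<exists>c. (\<forall>i. c i \<noteq> 0 \<longrightarrow> (q + 1) * i \<le> d) \<and>
    F = (\<Sum>i\<le>d. const3 (c i) * hermitian3 q ^ i * conic3 ^ ((d - (q + 1) * i) div 2)))"
proof -
  have inf: "infinite (UNIV :: 'k set)"
    using ac by (rule alg_closed_infinite)
  have two: "(2 :: 'k) \<noteq> 0"
    using CHAR_odd_two_neq_0[OF char] .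
  have odd: "odd q"
    using char q by simp
  note sym = invariant_curve_normalized[OF ac irr hom inv d(1) char odd]
  obtain H :: "'k poly poly" where H: "\<And>t y. eval2 H t y = eval3 F (1 / 2 * (y ^ 2 - t), y, 1)"
    using subst_affine_exists by blast
  obtain U :: "'k poly poly" where U: "\<And>t y. eval2 U t y = eval3 (hermitian3 q) (1 / 2 * (y ^ 2 - t), y, 1)"
    using subst_affine_exists by blast
  have affine: "1 / 2 * (y ^ 2 - (y ^ 2 - 2 * x)) = x" for x y :: 'k
    using two by simp
  have "affine_invariant q (int d) H"
    unfolding affine_invariant_def power_int_of_nat
  proof (intro conjI ballI allI impI)
    fix a t y :: 'k assume a: "a \<in> Fq q"
    have "1 / 2 * ((y + a) ^ 2 - t) = 1 / 2 * (y ^ 2 - t) + a * y + a ^ 2 / 2 * 1"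
    proof -
      have "(y + a) ^ 2 - t = (y ^ 2 - t) + 2 * (a * y) + a ^ 2"
        by (simp add: power2_sum algebra_simps)
      then show ?thesis
        using two by (simp only: distrib_left) simp
    qed
    then show "eval2 H t (y + a) = eval2 H t y"
      using sym(3)[OF a, of "1 / 2 * (y ^ 2 - t)" y 1] by (simp only: H mult_1_right)
  next
    fix b t y :: 'k assume b: "b \<in> Fq q" "b \<noteq> 0"
    have "1 / 2 * ((b * y) ^ 2 - b ^ 2 * t) = b ^ 2 * (1 / 2 * (y ^ 2 - t))"
      by (simp add: power_mult_distrib right_diff_distrib)
    then show "eval2 H (b ^ 2 * t) (b * y) = b ^ d * eval2 H t y"
      using sym(4)[OF b] by (simp only: H)
  next
    fix x y :: 'k assume x: "x \<noteq> 0"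
    \<comment> \<open>This is the swap on the chart: (x, y, 1) goes to (1, y, x), which is x times
      (1/x, y/x, 1).\<close>
    have "(y / x) ^ 2 - (y ^ 2 - 2 * x) / x ^ 2 = 2 * x / x ^ 2"
      by (simp add: power_divide diff_divide_distrib)
    then have "1 / 2 * ((y / x) ^ 2 - (y ^ 2 - 2 * x) / x ^ 2) = 1 / x"
      using x two by (simp add: power2_eq_square)
    then have "x ^ d * eval2 H ((y ^ 2 - 2 * x) / x ^ 2) (y / x) = x ^ d * eval3 F (1 / x, y / x, 1)"
      by (simp only: H)
    also have "\<dots> = eval3 F (1, y, x)"
      using eval3_scale_homogeneous[OF hom, of x "1 / x" "y / x" 1] x by simp
    also have "\<dots> = eval3 F (x, y, 1)"
      by (rule sym(2))
    finally show "x ^ d * eval2 H ((y ^ 2 - 2 * x) / x ^ 2) (y / x) = eval2 H (y ^ 2 - 2 * x) y"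
      by (simp only: H affine)
  qed
  then have "conic_expansion q U d H"
    using sym(1) d(2) by (intro affine_invariant_expansion[OF ac char q U])
  then obtain c where c: "\<And>i. c i \<noteq> 0 \<Longrightarrow> (q + 1) * i \<le> d"
    and c_H: "\<And>t y. eval2 H t y = (\<Sum>i\<le>d. c i * eval2 U t y ^ i * t ^ ((d - (q + 1) * i) div 2))"
    unfolding conic_expansion_def by blast
  define R :: "'k poly3" where "R = (\<Sum>i\<le>d. const3 (c i) * hermitian3 q ^ i * conic3 ^ ((d - (q + 1) * i) div 2))"
  have R: "eval3 R v = (\<Sum>i\<le>d. c i * eval3 (hermitian3 q) v ^ i * eval3 conic3 v ^ ((d - (q + 1) * i) div 2))" for v
    by (simp add: R_def)
  have FR1: "eval3 F (x, y, 1) = eval3 R (x, y, 1)" for x y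
  proof -
    have "eval3 F (x, y, 1) = eval2 H (y ^ 2 - 2 * x) y"
      by (simp only: H affine)
    also have "\<dots> = eval3 R (x, y, 1)"
      by (simp only: c_H R U affine eval3_conic3 mult_1_right)
    finally show ?thesis .
  qed
  have R_hom: "eval3 R (s * x, s * y, s * z) = s ^ d * eval3 R (x, y, z)" for s x y z
  proof -
    have U_hom: "eval3 (hermitian3 q) (s * x, s * y, s * z) = s ^ (q + 1) * eval3 (hermitian3 q) (x, y, z)"
      by (simp add: power_mult_distrib algebra_simps)
    have C_hom: "eval3 conic3 (s * x, s * y, s * z) = s ^ 2 * eval3 conic3 (x, y, z)"
      by (simp add: power_mult_distrib algebra_simps power2_eq_square)
    have "c i * (s ^ (q + 1) * u) ^ i * (s ^ 2 * w) ^ ((d - (q + 1) * i) div 2) =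
        s ^ d * (c i * u ^ i * w ^ ((d - (q + 1) * i) div 2))" for i u w
    proof (cases "c i = 0")
      case False
      have "even (d - (q + 1) * i)"
        using sym(1) odd by simp
      then have "(q + 1) * i + 2 * ((d - (q + 1) * i) div 2) = d"
        using c[OF False] by simp
      then have "s ^ d = (s ^ (q + 1)) ^ i * (s ^ 2) ^ ((d - (q + 1) * i) div 2)"
        by (metis power_add power_mult)
      then show ?thesis
        by (simp only: power_mult_distrib mult_ac)
    qed simp
    then show ?thesis
      by (simp only: R U_hom C_hom sum_distrib_left)
  qed
  have FR: "eval3 F (x, y, z) = eval3 R (x, y, z)" if "z \<noteq> 0" for x y z
    using eval3_scale_homogeneous[OF hom, of z "x / z" "y / z" 1] R_hom[of z "x / z" "y / z" 1] FR1 that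
    by simp
  \<comment> \<open>By homogeneity the expansion passes from the chart to all points with z nonzero.
    The factor Z takes care of the plane z = 0 and is then cancelled.\<close>
  have "varZ * (F - R) = 0"
  proof (rule eval3_eq_0[OF inf])
    fix v :: "'k \<times> 'k \<times> 'k"
    show "eval3 (varZ * (F - R)) v = 0"
      using FR by (cases v) auto
  qed
  moreover have "varZ \<noteq> (0 :: 'k poly3)"
    by (simp add: varZ_def mono3_def)
  ultimately have "F = R"
    by simp
  then show ?thesis
    using sym(1) c unfolding R_def by blast
qed

theorem mainTheorem14:
  fixes p q n d :: nat and F :: "'k::field poly3"
  assumes "prime p" and "odd p" and "n \<ge> 1" and "q = p ^ n"
    and "CHAR('k) = p"
    and "alg_closed TYPE('k)"
    and "algebraic_over (Fq q :: 'k set)"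
    and "F \<noteq> 0" and "homogeneous3 F d" and "irreducible F"
    and "invariant_curve q F"
    and "2 < d" and "d < q ^ 2 - q"
  shows "(\<exists>c. c \<noteq> 0 \<and> F = const3 c * hermitian3 q)
       \<or> (\<exists>lam c. c \<noteq> 0 \<and>
            F = const3 c * (hermitian3 q - const3 lam * conic3 ^ ((q + 1) div 2)))"
proof -
  have inf: "infinite (UNIV :: 'k set)"
    using assms(6) by (rule alg_closed_infinite)
  have odd: "odd q"
    using assms by simp
  have "1 < d"
    using assms(12) by simp
  note expansion = invariant_curve_expansion[OF assms(6,5,1,2,4,3,10,9,11) this assms(13)]
  have even: "even d"
    using expansion by (rule conjunct1)
  have "\<exists>c. (\<forall>i. c i \<noteq> 0 \<longrightarrow> (q + 1) * i \<le> d) \<and>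
    F = (\<Sum>i\<le>d. const3 (c i) * hermitian3 q ^ i * conic3 ^ ((d - (q + 1) * i) div 2))"
    using expansion by (rule conjunct2)
  then obtain c where c: "\<And>i. c i \<noteq> 0 \<Longrightarrow> (q + 1) * i \<le> d"
    and F: "F = (\<Sum>i\<le>d. const3 (c i) * hermitian3 q ^ i * conic3 ^ ((d - (q + 1) * i) div 2))"
    by blast
  have const3_0: "const3 (0 :: 'k) = 0"
    by (simp add: const3_def mono3_def)
  \<comment> \<open>An irreducible multiple of the conic would have degree 2. Hence some term of the
    expansion contains no factor \<open>conic3\<close>, and this forces \<open>d\<close> to be a
    multiple of q + 1.\<close>
  have "\<not> conic3 dvd F"
  proof
    assume "conic3 dvd F"
    then have "d = 2"
      by (rule irreducible_factor_degree[OF inf assms(10,9), of _ "(1, 0, 0)"])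
        (simp_all add: power2_eq_square algebra_simps)
    then show False
      using assms(12) by simp
  qed
  then have "\<not> (\<forall>i\<in>{..d}. conic3 dvd const3 (c i) * hermitian3 q ^ i * conic3 ^ ((d - (q + 1) * i) div 2))"
    unfolding F by (metis (no_types, lifting) dvd_sum)
  then obtain M where M_ndvd: "\<not> conic3 dvd const3 (c M) * hermitian3 q ^ M * conic3 ^ ((d - (q + 1) * M) div 2)"
    by blast
  have cM: "c M \<noteq> 0"
  proof
    assume "c M = 0"
    then show False
      using M_ndvd by (simp add: const3_0)
  qed
  have "(d - (q + 1) * M) div 2 = 0"
  proof (rule ccontr)
    assume "(d - (q + 1) * M) div 2 \<noteq> 0"
    then have "conic3 dvd (conic3 :: 'k poly3) ^ ((d - (q + 1) * M) div 2)"
      by (intro dvd_power) simp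
    then show False
      using M_ndvd dvd_mult by metis
  qed
  moreover have "even (d - (q + 1) * M)"
    using even odd by simp
  ultimately have "d - (q + 1) * M = 0"
    by presburger
  then have d: "d = (q + 1) * M"
    using c[OF cM] by simp
  then have M: "M \<ge> 1"
    using assms(12) by (cases M) auto
  define N where "N = (q + 1) div 2"
  have N: "q + 1 = 2 * N"
    using odd by (simp add: N_def)
  have F_M: "F = (\<Sum>i\<le>M. const3 (c i) * hermitian3 q ^ i * (conic3 ^ N) ^ (M - i))"
  proof -
    have "F = (\<Sum>i\<le>M. const3 (c i) * hermitian3 q ^ i * conic3 ^ ((d - (q + 1) * i) div 2))"
      unfolding F
    proof (rule sum.mono_neutral_right)
      have "c i = 0" if "i > M" for i
        using c[of i] that unfolding d Suc_eq_plus1[symmetric] Suc_mult_le_cancel1 by linarith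
      then show "\<forall>i\<in>{..d} - {..M}. const3 (c i) * hermitian3 q ^ i * conic3 ^ ((d - (q + 1) * i) div 2) = 0"
        by (auto simp: const3_0)
    qed (use d in auto)
    moreover have "(d - (q + 1) * i) div 2 = N * (M - i)" for i
    proof -
      have "d - (q + 1) * i = 2 * (N * (M - i))"
        unfolding d N by (simp add: diff_mult_distrib2 mult.assoc)
      then show ?thesis
        by simp
    qed
    ultimately show ?thesis
      by (simp add: power_mult)
  qed
  \<comment> \<open>\<open>F\<close> is now a binary form of degree \<open>M\<close> in the
    Hermitian form and \<open>conic3 ^ N\<close>, and \<open>P\<close> is its dehomogenization. A
    root of \<open>P\<close> is a value of \<lambda>, the root 0 giving the Hermitian curve.\<close>
  define P where "P = (\<Sum>i\<le>M. monom (c i) i)"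
  have "coeff P M = c M"
    by (simp add: P_def coeff_sum)
  then have "degree P \<ge> 1"
    using cM M le_degree[of P M] by simp
  then obtain r where "poly P r = 0"
    using assms(6) unfolding alg_closed_def by blast
  then have "(\<Sum>i\<le>M. c i * r ^ i) = 0"
    by (simp add: P_def poly_sum poly_monom)
  then have "hermitian3 q - const3 r * conic3 ^ N dvd F"
    unfolding F_M by (rule homogeneous_root_dvd[OF inf])
  \<comment> \<open>The point (1, 0, 0) lies on the conic and on the Hermitian curve, hence on every
    member of the pencil; it shows that the factor is not a unit.\<close>
  moreover have "eval3 (hermitian3 q - const3 r * conic3 ^ N) (1, 0, 0) = 0"
    using N odd_pos[OF odd] by (auto simp: power_0_left)
  ultimately have "\<exists>a. a \<noteq> 0 \<and> F = const3 a * (hermitian3 q - const3 r * conic3 ^ N)"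
    by (rule irreducible_factor_proportional[OF assms(10)])
  then show ?thesis
    unfolding N_def by blast
qed

end
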